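(* Let $\kappa, r, \ell$ be nonnegative integers and let $g$ be of the form $$g=\frac{b_2+b_1}{b_2-b_1}\quad\text{where}\quad b_1\in\mathcal{B}_\ell,\quad b_2\in\mathcal{B}_r\quad\text{and}\quad Z(b_1)\cap Z(b_2)=\emptyset.$$ Assume that a function $h\in\mathcal{C}_{\le\kappa}$ satisfies the asymptotic equations $$h(z)=g(z)+o((z-t_i)^{m_i})\quad\text{as } z\in\mathbb{D}\text{ tends to } t_i \text{ nontangentially},\qquad i=1,\ldots,n,$$ at some distinct points $t_1,\ldots,t_n\in\mathbb{T}$ and for some nonnegative integers $m_1,\ldots,m_n$ such that $$\left[\frac{m_1+1}{2}\right]+\ldots+\left[\frac{m_n+1}{2}\right]>\kappa+\ell.$$ Then $h\equiv g$.
   Context: $\mathbb{D}$ is the open unit disk and $\mathbb{T}$ the unit circle in $\mathbb{C}$. $[x]$ denotes the largest integer not exceeding the real number $x$. $\mathcal{B}_k$ is the set of all finite Blaschke products of degree $k$ on $\mathbb{D}$ (a unimodular constant factor is allowed; $\mathcal{B}_0$ consists of unimodular constants). $Z(b)$ is the zero set of $b$ (in $\mathbb{D}$). A Hermitian kernel $K(z,\zeta)$ on a set $\Omega$ has $k$ negative squares if for every finite choice of points $z_1,\ldots,z_N\in\Omega$ the Hermitian matrix $[K(z_i,z_j)]_{i,j=1}^N$ has at most $k$ negative eigenvalues (counted with multiplicity), and exactly $k$ for at least one such choice. The generalized Carathéodory class $\mathcal{C}_k$ consists of all functions $h$ meromorphic on $\mathbb{D}$ such that the kernel $$C_h(z,\zeta)=\frac{h(z)+\overline{h(\zeta)}}{1-z\overline{\zeta}}$$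 has $k$ negative squares on $\mathbb{D}\cap\mathrm{Dom}(h)$, where $\mathrm{Dom}(h)$ is the domain of analyticity of $h$; by convention the function $h\equiv\infty$ is also included in $\mathcal{C}_0$. Further, $\mathcal{C}_{\le\kappa}=\bigcup_{q\le\kappa}\mathcal{C}_q$. "$z$ tends to $t$ nontangentially" means that $z\to t$ within any fixed nontangential approach region (Stolz angle) in $\mathbb{D}$ with vertex $t\in\mathbb{T}$. The asymptotic equations are statements about the difference $h-g$, and so presuppose that neither $h$ nor $g$ is identically $\infty$. *)

theory Defs
  imports
    "HOL-Complex_Analysis.Complex_Analysis"
    "HOL-Library.Landau_Symbols"
    "Jordan_Normal_Form.Char_Poly"
begin

(* Only the values on the open unit disk are prescribed. *)
definition blaschke_products :: "nat \<Rightarrow> (complex \<Rightarrow> complex) set" where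
  "blaschke_products k =
     {b. \<exists>c a. norm c = 1 \<and> (\<forall>i<k. a i \<in> ball 0 1) \<and>
        (\<forall>z\<in>ball 0 1. b z = c * (\<Prod>i<k. (z - a i) / (1 - cnj (a i) * z)))}"

definition disk_zeros :: "(complex \<Rightarrow> complex) \<Rightarrow> complex set" where
  "disk_zeros b = {z \<in> ball 0 1. b z = 0}"

(* The eigenvalues of a Hermitian matrix are real, so that its negative eigenvalues are exactly
   the negative reals among its eigenvalues; the multiplicity is that of a root of the
   characteristic polynomial. *)
definition num_negative_eigenvalues :: "complex mat \<Rightarrow> nat" where
  "num_negative_eigenvalues A =
     (\<Sum>x\<in>{x::real. x < 0 \<and> eigenvalue A (complex_of_real x)}.
        Polynomial.order (complex_of_real x) (char_poly A))"

definition kernel_matrix :: "('a \<Rightarrow> 'a \<Rightarrow> complex) \<Rightarrow> 'a list \<Rightarrow> complex mat" where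
  "kernel_matrix K zs = mat (length zs) (length zs) (\<lambda>(i, j). K (zs ! i) (zs ! j))"

definition has_negative_squares :: "('a \<Rightarrow> 'a \<Rightarrow> complex) \<Rightarrow> 'a set \<Rightarrow> nat \<Rightarrow> bool" where
  "has_negative_squares K \<Omega> k \<longleftrightarrow>
     (\<forall>z\<in>\<Omega>. \<forall>\<zeta>\<in>\<Omega>. K \<zeta> z = cnj (K z \<zeta>)) \<and>
     (\<forall>zs. set zs \<subseteq> \<Omega> \<longrightarrow> num_negative_eigenvalues (kernel_matrix K zs) \<le> k) \<and>
     (\<exists>zs. set zs \<subseteq> \<Omega> \<and> num_negative_eigenvalues (kernel_matrix K zs) = k)"

definition caratheodory_kernel :: "(complex \<Rightarrow> complex) \<Rightarrow> complex \<Rightarrow> complex \<Rightarrow> complex" where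
  "caratheodory_kernel h z \<zeta> = (h z + cnj (h \<zeta>)) / (1 - z * cnj \<zeta>)"

(* A meromorphic function on the disk is represented by its unique representative that is
   continuous wherever it has no pole and takes the default value 0 at its poles; two such
   functions are equal as meromorphic functions iff their representatives agree on the disk.
   The constant function infinity, conventionally a member of the class for k = 0, is not a
   complex-valued function and is left out. *)
definition caratheodory_class :: "nat \<Rightarrow> (complex \<Rightarrow> complex) set" where
  "caratheodory_class k =
     {h. h nicely_meromorphic_on ball 0 1 \<and>
         has_negative_squares (caratheodory_kernel h) {z \<in> ball 0 1. h analytic_on {z}} k}"

definition caratheodory_class_le :: "nat \<Rightarrow> (complex \<Rightarrow> complex) set" where
  "caratheodory_class_le \<kappa> = (\<Union>q\<le>\<kappa>. caratheodory_class q)"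

definition stolz_region :: "complex \<Rightarrow> real \<Rightarrow> complex set" where
  "stolz_region t M = {z \<in> ball 0 1. norm (z - t) < M * (1 - norm z)}"

end

theory Submission
  imports Defs "Jordan_Normal_Form.Schur_Decomposition"
begin

text \<open>
  Put \<open>\<phi> = b\<^sub>2 (h - 1) / (h + 1)\<close>.  The choice \<open>h = g\<close> gives \<open>\<phi> = b\<^sub>1\<close>, and in general
  \<open>\<phi> - b\<^sub>1 = (b\<^sub>2 - b\<^sub>1) (h - g) / (h + 1)\<close>, where \<open>h + 1\<close> stays away from \<open>0\<close> along the radius to \<open>t\<^sub>i\<close>
  because \<open>g\<close> has there a boundary value that is imaginary or infinite.  So the asymptotic equations say that
  \<open>\<phi>\<close> agrees with \<open>b\<^sub>1\<close> at \<open>t\<^sub>i\<close> up to \<open>o((z - t\<^sub>i)^m\<^sub>i)\<close>.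

  For a function \<open>f\<close> consider the kernel \<open>S\<^sub>f(z, w) = (1 - f(z) cnj (f(w))) / (1 - z cnj w)\<close>.  Two facts about
  such kernels carry the proof.  First, \<open>S\<^sub>b\<close> of a Blaschke product of degree \<open>l\<close> is a sum of \<open>l\<close> squares
  (lemma \<open>blaschke_kernel_decomposition\<close>).  Secondly, \<open>S\<^sub>\<phi>\<close> is the sum of the positive kernel of \<open>b\<^sub>2\<close> and of
  the Caratheodory kernel of \<open>h\<close>, multiplied by a function of \<open>z\<close> and by the conjugate of the same function of
  \<open>w\<close>.  Hence \<open>S\<^sub>\<phi>\<close> has at most \<open>\<kappa>\<close> negative squares (lemma \<open>cayley_kernel_nonneg_vector\<close>).

  Let \<open>n\<^sub>i = (m\<^sub>i + 1) div 2\<close> and look at the functionals that combine the derivatives of orders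
  \<open>0, ..., n\<^sub>i - 1\<close> at the points \<open>t\<^sub>i\<close>.  They form a space of dimension \<open>\<Sum>n\<^sub>i > \<kappa> + l\<close>.  Pairing two of them
  involves \<open>\<phi>\<close> only up to order \<open>2 n\<^sub>i - 1 \<le> m\<^sub>i\<close>, so that \<open>S\<^sub>\<phi>\<close> and the kernel of \<open>b\<^sub>1\<close> induce the same form
  on this space.  This form has rank at most \<open>l\<close>, and more than \<open>\<kappa>\<close> dimensions remain in its null space.
  If \<open>\<kappa> + 1\<close> null functionals could be separated by \<open>\<kappa> + 1\<close> points of the disk, then the Gram matrix of these
  functionals and point evaluations would be, in blocks, \<open>0\<close>, \<open>I\<close>, \<open>I\<close>, \<open>*\<close>, which has \<open>\<kappa> + 1\<close> negative
  squares.  So some null functional \<open>\<Lambda> \<noteq> 0\<close> pairs to \<open>0\<close> with every point of the disk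
  (lemma \<open>exists_annihilating_jet\<close>).  With \<open>k\<^sub>w(z) = 1 / (1 - z cnj w)\<close> this means
  \<open>\<Lambda>(k\<^sub>w) = cnj (\<phi>(w)) \<Lambda>(b\<^sub>1 k\<^sub>w)\<close>, and also \<open>\<Lambda>(k\<^sub>w) = cnj (b\<^sub>1(w)) \<Lambda>(b\<^sub>1 k\<^sub>w)\<close>.
  As \<open>\<Lambda>(k\<^sub>w)\<close> is a rational function of \<open>cnj w\<close> that vanishes identically only for \<open>\<Lambda> = 0\<close>
  (lemma \<open>jet_functional_of_resolvent_nonzero\<close>), \<open>\<phi> = b\<^sub>1\<close> off a discrete set, which is \<open>h = g\<close> there,
  and then everywhere.

  Since \<open>h\<close> is not defined on the circle, the derivatives at \<open>t\<^sub>i\<close> are realised as limits of divided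
  differences on radial nodes \<open>t\<^sub>i (1 - \<epsilon>\<^sub>i j)\<close>, \<open>j = 1, ..., n\<^sub>i\<close>.  The step sizes are tied together by
  \<open>\<epsilon>\<^sub>i^n\<^sub>i = \<eta>\<close> with a common \<open>\<eta>\<close> tending to \<open>0\<close>; this makes one estimate serve for all pairs of nodes,
  on the same radius or on different ones.
\<close>

unbundle no vec_syntax

section \<open>Negative eigenvalues of Hermitian forms\<close>

text \<open>
  Gaussian elimination of one unknown with one equation.
\<close>

lemma homogeneous_system_nontrivial:
  fixes c :: "'j \<Rightarrow> 'i \<Rightarrow> 'a::field"
  assumes "finite J" "finite I" "card J < card I"
  shows "\<exists>x. (\<exists>i\<in>I. x i \<noteq> 0) \<and> (\<forall>j\<in>J. (\<Sum>i\<in>I. c j i * x i) = 0)"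
  using assms
proof (induction J arbitrary: I c rule: finite_induct)
  case empty
  then obtain i where "i \<in> I" by fastforce
  then show ?case by (intro exI[of _ "\<lambda>_. 1"]) auto
next
  case (insert j J)
  show ?case
  proof (cases "\<forall>i\<in>I. c j i = 0")
    case True
    obtain x where "\<exists>i\<in>I. x i \<noteq> 0" "\<forall>j\<in>J. (\<Sum>i\<in>I. c j i * x i) = 0"
      using insert.IH[of I c] insert.prems insert.hyps by auto
    with True show ?thesis by (intro exI[of _ x]) auto
  next
    case False
    then obtain i0 where i0: "i0 \<in> I" "c j i0 \<noteq> 0" by blast
    define I' where "I' = I - {i0}"
    have I': "finite I'" "card J < card I'" "i0 \<notin> I'" "I = insert i0 I'"
      using insert.prems insert.hyps i0 by (auto simp: I'_def)
    obtain x where x: "\<exists>i\<in>I'. x i \<noteq> 0"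
      and eq: "\<And>k. k \<in> J \<Longrightarrow> (\<Sum>i\<in>I'. (c k i - c k i0 * c j i / c j i0) * x i) = 0"
      using insert.IH[of I' "\<lambda>k i. c k i - c k i0 * c j i / c j i0"] I'(1,2) by auto
    define x' where "x' = x(i0 := - (\<Sum>i\<in>I'. c j i * x i) / c j i0)"
    have sum: "(\<Sum>i\<in>I. c k i * x' i) = c k i0 * x' i0 + (\<Sum>i\<in>I'. c k i * x i)" for k
    proof -
      have "(\<Sum>i\<in>I'. c k i * x' i) = (\<Sum>i\<in>I'. c k i * x i)"
        using I'(3) by (intro sum.cong) (auto simp: x'_def)
      then show ?thesis using I' by simp
    qed
    have "(\<Sum>i\<in>I. c k i * x' i) = 0" if "k \<in> J" for k
    proof -
      have "(\<Sum>i\<in>I'. c k i * x i) = (\<Sum>i\<in>I'. c k i0 / c j i0 * (c j i * x i))"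
        using eq[OF that] by (simp add: algebra_simps sum_subtractf)
      then show ?thesis unfolding sum by (simp add: x'_def sum_distrib_left sum_divide_distrib)
    qed
    moreover have "(\<Sum>i\<in>I. c j i * x' i) = 0"
      unfolding sum using i0 by (simp add: x'_def)
    moreover have "\<exists>i\<in>I. x' i \<noteq> 0"
      using x I'(3,4) by (auto simp: x'_def)
    ultimately show ?thesis by blast
  qed
qed

lemma index_mult_sum:
  assumes "X \<in> carrier_mat n n" "Y \<in> carrier_mat n n" "i < n" "j < n"
  shows "(X * Y) $$ (i, j) = (\<Sum>m<n. X $$ (i, m) * Y $$ (m, j))"
  using assms by (auto simp: scalar_prod_def atLeast0LessThan intro!: sum.cong)

lemma mat_adjoint_square:
  assumes "U \<in> carrier_mat n n"
  shows "mat_adjoint U \<in> carrier_mat n n"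
    and "\<And>i j. i < n \<Longrightarrow> j < n \<Longrightarrow> mat_adjoint U $$ (i, j) = conjugate (U $$ (j, i))"
  using assms by (auto simp: mat_adjoint_def mat_of_rows_def)

lemma index_adjoint_mult:
  fixes U V :: "complex mat"
  assumes "U \<in> carrier_mat n n" "V \<in> carrier_mat n n" "i < n" "j < n"
  shows "(mat_adjoint U * V) $$ (i, j) = (\<Sum>k<n. cnj (U $$ (k, i)) * V $$ (k, j))"
  using assms mat_adjoint_square[OF assms(1)]
  by (auto simp: scalar_prod_def atLeast0LessThan intro!: sum.cong)

text \<open>
  Gram-Schmidt applied to a basis that starts with \<open>v\<close> yields orthogonal columns, which are then normalised.
\<close>

lemma unitary_extending_vector:
  fixes v :: "complex vec"
  assumes v: "v \<in> carrier_vec n" "v \<noteq> 0\<^sub>v n"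
  shows "\<exists>W\<in>carrier_mat n n. mat_adjoint W * W = 1\<^sub>m n \<and>
           (\<exists>c. \<forall>i<n. W $$ (i, 0) = c * v $ i)"
proof -
  interpret cof_vec_space n "TYPE(complex)" .
  define b where "b = basis_completion v"
  define ws where "ws = gram_schmidt n b"
  from basis_completion[OF v, folded b_def]
  have dist_b: "distinct b"
    and indep: "\<not> lin_dep (set b)" and b: "set b \<subseteq> carrier_vec n" and hdb: "hd b = v"
    and len_b: "length b = n" by auto
  have n: "n \<noteq> 0" using v by (cases "n = 0") auto
  from hdb len_b n obtain vs where bv: "b = v # vs" by (cases b, auto)
  from gram_schmidt_result[OF b dist_b indep refl, folded ws_def]
  have ws: "set ws \<subseteq> carrier_vec n" "corthogonal ws" "length ws = n"
    by (auto simp: len_b)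
  from gram_schmidt_hd[OF v(1), of vs, folded bv] have hdws: "hd ws = v" unfolding ws_def .
  have car: "ws ! i \<in> carrier_vec n" if "i < n" for i using ws that by auto
  define N where "N = (\<lambda>i. sqrt (\<Sum>k<n. (cmod (ws ! i $ k))\<^sup>2))"
  define W where "W = mat n n (\<lambda>(i,j). ws ! j $ i / of_real (N j))"
  have W: "W \<in> carrier_mat n n" by (simp add: W_def)
  have sp: "ws ! j \<bullet>c ws ! i = (\<Sum>k<n. ws ! j $ k * cnj (ws ! i $ k))" if "i < n" "j < n" for i j
    using car[OF that(1)] car[OF that(2)]
    by (auto simp: scalar_prod_def atLeast0LessThan intro!: sum.cong)
  have N2: "(\<Sum>k<n. ws ! i $ k * cnj (ws ! i $ k)) = of_real ((N i)\<^sup>2)" for i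
    unfolding N_def by (simp add: sum_nonneg complex_norm_square[symmetric] del: of_real_sum)
       (simp add: complex_norm_square)
  have N0: "N i \<noteq> 0" if "i < n" for i
    using corthogonalD[OF ws(2), of i i] sp[OF that that] N2[of i] ws(3) that by auto
  have "mat_adjoint W * W = 1\<^sub>m n"
  proof (rule eq_matI)
    fix i j assume "i < dim_row (1\<^sub>m n :: complex mat)" "j < dim_col (1\<^sub>m n :: complex mat)"
    then have ij: "i < n" "j < n" by auto
    have "(mat_adjoint W * W) $$ (i, j)
        = (\<Sum>k<n. ws ! j $ k * cnj (ws ! i $ k)) / of_real (N i * N j)"
      unfolding index_adjoint_mult[OF W W ij] sum_divide_distrib
      using ij by (intro sum.cong) (auto simp: W_def)
    also have "\<dots> = 1\<^sub>m n $$ (i, j)"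
    proof (cases "i = j")
      case True
      then show ?thesis using N2[of i] N0[of i] ij by (simp add: power2_eq_square)
    next
      case False
      then have "ws ! j \<bullet>c ws ! i = 0"
        using corthogonalD[OF ws(2), of j i] ws(3) ij by auto
      then show ?thesis using False sp[OF ij] ij by simp
    qed
    finally show "(mat_adjoint W * W) $$ (i, j) = 1\<^sub>m n $$ (i, j)" .
  qed (use mat_adjoint_square[OF W] W in auto)
  moreover have "W $$ (i, 0) = 1 / of_real (N 0) * v $ i" if "i < n" for i
  proof -
    have "ws ! 0 = v" using hdws ws(3) n by (cases ws) auto
    then show ?thesis using that n by (simp add: W_def)
  qed
  ultimately show ?thesis using W by blast
qed

text \<open>
  The spectral theorem, by deflation: a unitary matrix whose first column is an eigenvector turns \<open>A\<close> into a
  matrix with a diagonal first column.  As the new matrix is again Hermitian, its first row is diagonal as well,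
  and the remaining block has smaller size.
\<close>

lemma hermitian_diagonalization:
  fixes A :: "complex mat"
  assumes "A \<in> carrier_mat n n" "\<And>i j. i < n \<Longrightarrow> j < n \<Longrightarrow> A $$ (i, j) = cnj (A $$ (j, i))"
  shows "\<exists>U\<in>carrier_mat n n. \<exists>d :: nat \<Rightarrow> real. mat_adjoint U * U = 1\<^sub>m n \<and>
           A * U = U * mat n n (\<lambda>(i, j). if i = j then of_real (d i) else 0)"
  using assms
proof (induction n arbitrary: A)
  case 0
  have "mat_adjoint A * A = 1\<^sub>m 0"
    by (rule eq_matI) (use 0 mat_adjoint_square[of A 0] in auto)
  moreover have "A * A = A * mat 0 0 (\<lambda>(i, j). if i = j then of_real ((\<lambda>_. 0) i) else 0)"
    by (rule eq_matI) (use 0 in auto)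
  ultimately show ?case
    by (intro bexI[where x = A] exI[where x = "\<lambda>_. 0"] conjI) (use 0(1) in simp_all)
next
  case (Suc n A)
  note A = Suc.prems(1)
  obtain e where "poly (char_poly A) e = 0"
  proof -
    have "degree (char_poly A) = Suc n" using degree_monic_char_poly[OF A] by simp
    then have "\<not> constant (poly (char_poly A))" by (simp add: constant_degree)
    with fundamental_theorem_of_algebra that show thesis by blast
  qed
  then have "eigenvalue A e" by (simp add: eigenvalue_root_char_poly[OF A])
  then obtain v where v: "v \<in> carrier_vec (Suc n)" "v \<noteq> 0\<^sub>v (Suc n)" and Av: "A *\<^sub>v v = e \<cdot>\<^sub>v v"
    using A unfolding eigenvalue_def eigenvector_def by auto
  obtain W c where W: "W \<in> carrier_mat (Suc n) (Suc n)" and WW: "mat_adjoint W * W = 1\<^sub>m (Suc n)"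
    and c: "\<And>i. i < Suc n \<Longrightarrow> W $$ (i, 0) = c * v $ i"
    using unitary_extending_vector[OF v] by blast
  note W' = mat_adjoint_square[OF W]
  have WW': "W * mat_adjoint W = 1\<^sub>m (Suc n)"
    using mat_mult_left_right_inverse[OF W'(1) W WW] .
  define B where "B = mat_adjoint W * (A * W)"
  have B: "B \<in> carrier_mat (Suc n) (Suc n)" unfolding B_def using W W' A by auto
  have AW: "A * W \<in> carrier_mat (Suc n) (Suc n)" using A W by auto
  have AWi: "(A * W) $$ (i, j) = (\<Sum>k<Suc n. A $$ (i, k) * W $$ (k, j))"
    if "i < Suc n" "j < Suc n" for i j
    using that A W by (auto simp: scalar_prod_def atLeast0LessThan simp del: sum.lessThan_Suc intro!: sum.cong)
  have Bi: "B $$ (i, j) = (\<Sum>k<Suc n. cnj (W $$ (k, i)) * (\<Sum>l<Suc n. A $$ (k, l) * W $$ (l, j)))"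
    if "i < Suc n" "j < Suc n" for i j
    unfolding B_def index_adjoint_mult[OF W AW that] by (intro sum.cong refl) (simp only: AWi that lessThan_iff)
  have Bh: "B $$ (i, j) = cnj (B $$ (j, i))" if ij: "i < Suc n" "j < Suc n" for i j
  proof -
    have "cnj (B $$ (j, i)) = (\<Sum>k<Suc n. \<Sum>l<Suc n. W $$ (k, j) * (cnj (A $$ (k, l)) * cnj (W $$ (l, i))))"
      unfolding Bi[OF ij(2,1)] by (simp only: sum_distrib_left cnj_sum complex_cnj_mult complex_cnj_cnj)
    also have "\<dots> = (\<Sum>l<Suc n. \<Sum>k<Suc n. W $$ (k, j) * (cnj (A $$ (k, l)) * cnj (W $$ (l, i))))"
      by (rule sum.swap)
    also have "\<dots> = B $$ (i, j)"
      unfolding Bi[OF ij] sum_distrib_left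
    proof (intro sum.cong refl, goal_cases)
      case (1 l k)
      then show ?case using Suc.prems(2)[of l k] by simp
    qed
    finally show ?thesis by simp
  qed
  have B0: "B $$ (i, 0) = (if i = 0 then e else 0)" if i: "i < Suc n" for i
  proof -
    have "(\<Sum>l<Suc n. A $$ (k, l) * W $$ (l, 0)) = e * W $$ (k, 0)" if k: "k < Suc n" for k
    proof -
      have "(\<Sum>l<Suc n. A $$ (k, l) * W $$ (l, 0)) = c * (A *\<^sub>v v) $ k"
        using k A v c by (auto simp: scalar_prod_def atLeast0LessThan sum_distrib_left simp del: sum.lessThan_Suc intro!: sum.cong)
      also have "\<dots> = e * W $$ (k, 0)" unfolding Av using k v c by simp
      finally show ?thesis .
    qed
    then have "B $$ (i, 0) = (\<Sum>k<Suc n. e * (cnj (W $$ (k, i)) * W $$ (k, 0)))"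
      unfolding Bi[OF i zero_less_Suc] by (intro sum.cong) auto
    also have "\<dots> = e * (mat_adjoint W * W) $$ (i, 0)"
      unfolding index_adjoint_mult[OF W W i zero_less_Suc] by (simp only: sum_distrib_left)
    finally show ?thesis unfolding WW using i by simp
  qed
  have e: "e = of_real (Re e)"
    using Bh[of 0 0] B0[of 0] by (simp add: complex_eq_iff)
  define A' where "A' = mat n n (\<lambda>(i, j). B $$ (Suc i, Suc j))"
  have A': "A' \<in> carrier_mat n n" by (simp add: A'_def)
  have B_block: "B = four_block_mat (mat 1 1 (\<lambda>_. e)) (0\<^sub>m 1 n) (0\<^sub>m n 1) A'"
  proof (rule eq_matI, goal_cases)
    case (1 i j)
    then show ?case using B0[of i] Bh[of i j] B0[of j]
      by (cases i; cases j) (auto simp: A'_def)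
  qed (use B A' in auto)
  have "A' $$ (i, j) = cnj (A' $$ (j, i))" if "i < n" "j < n" for i j
    using Bh[of "Suc i" "Suc j"] that unfolding A'_def by simp
  note IH = Suc.IH[OF A' this]
  obtain U' d where U': "U' \<in> carrier_mat n n" "mat_adjoint U' * U' = 1\<^sub>m n"
    and d: "A' * U' = U' * mat n n (\<lambda>(i, j). if i = j then of_real (d i) else 0)"
    using IH by blast
  define d' where "d' = (\<lambda>i. case i of 0 \<Rightarrow> Re e | Suc i \<Rightarrow> d i)"
  define V where "V = four_block_mat (1\<^sub>m 1) (0\<^sub>m 1 n) (0\<^sub>m n 1) U'"
  define D' where "D' = mat n n (\<lambda>(i, j). if i = j then complex_of_real (d i) else 0)"
  define D where "D = mat (Suc n) (Suc n) (\<lambda>(i, j). if i = j then complex_of_real (d' i) else 0)"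
  have D': "D' \<in> carrier_mat n n" and D: "D \<in> carrier_mat (Suc n) (Suc n)" by (auto simp: D'_def D_def)
  have V: "V \<in> carrier_mat (Suc n) (Suc n)" using U' by (auto simp: V_def)
  have D_block: "D = four_block_mat (mat 1 1 (\<lambda>_. e)) (0\<^sub>m 1 n) (0\<^sub>m n 1) D'"
  proof (rule eq_matI, goal_cases)
    case (1 i j)
    then show ?case using e by (cases i; cases j) (auto simp: D_def D'_def d'_def)
  qed (auto simp: D_def D'_def)
  have V_adj: "mat_adjoint V = four_block_mat (1\<^sub>m 1) (0\<^sub>m 1 n) (0\<^sub>m n 1) (mat_adjoint U')"
  proof (rule eq_matI, goal_cases)
    case (1 i j)
    then have ij: "i < Suc n" "j < Suc n" using mat_adjoint_square[OF U'(1)] by auto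
    then show ?case using mat_adjoint_square[OF V] mat_adjoint_square[OF U'(1)] U'
      by (cases i; cases j) (auto simp: V_def)
  qed (use mat_adjoint_square[OF V] mat_adjoint_square[OF U'(1)] in auto)
  have VV: "mat_adjoint V * V = 1\<^sub>m (Suc n)"
    unfolding V_adj unfolding V_def
    by (subst mult_four_block_mat[of _ 1 1 _ n _ n _ _ 1 _ n])
       (use U' mat_adjoint_square[OF U'(1)] in \<open>auto intro!: eq_matI\<close>)
  have BV: "B * V = V * D"
    unfolding B_block D_block V_def
    by (subst mult_four_block_mat[of _ 1 1 _ n _ n _ _ 1 _ n],
        use U' A' D' in auto)+
       (use U' A' D' d in \<open>auto simp: D'_def\<close>)
  define U where "U = W * V"
  have U: "U \<in> carrier_mat (Suc n) (Suc n)" using W V by (simp add: U_def)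
  have "mat_adjoint U = mat_adjoint V * mat_adjoint W"
  proof (rule eq_matI, goal_cases)
    case (1 i j)
    then have ij: "i < Suc n" "j < Suc n" using mat_adjoint_square[OF V] W' by auto
    show ?case
      using mat_adjoint_square[OF U] mat_adjoint_square[OF V] W' W V ij
      by (auto simp: U_def scalar_prod_def atLeast0LessThan simp del: sum.lessThan_Suc intro!: sum.cong)
  qed (use mat_adjoint_square[OF U] mat_adjoint_square[OF V] W' in auto)
  then have "mat_adjoint U * U = mat_adjoint V * (mat_adjoint W * W) * V"
    unfolding U_def using W V W'(1) mat_adjoint_square(1)[OF V]
    by (simp add: assoc_mult_mat[of _ "Suc n" "Suc n" _ "Suc n" _ "Suc n"])
  then have 1: "mat_adjoint U * U = 1\<^sub>m (Suc n)"
    unfolding WW using VV mat_adjoint_square(1)[OF V] by simp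
  have "A * W = W * B"
    using assoc_mult_mat[OF W W'(1) AW] left_mult_one_mat[OF AW] unfolding B_def WW' by simp
  then have "A * U = W * (B * V)"
    unfolding U_def using assoc_mult_mat[OF A W V] assoc_mult_mat[OF W B V] by simp
  also have "\<dots> = U * D" unfolding BV U_def using assoc_mult_mat[OF W V D] by simp
  finally show ?case using U 1 unfolding D_def by blast
qed


lemma order_prod_linear:
  fixes d :: "nat \<Rightarrow> complex"
  shows "Polynomial.order x (\<Prod>i<n. [:- d i, 1:]) = card {i. i < n \<and> d i = x}"
proof (induction n)
  case 0
  then show ?case by simp
next
  case (Suc n)
  have nz: "(\<Prod>i<m. [:- d i, 1:]) \<noteq> 0" for m by simp
  have "Polynomial.order x [:- d n, 1:] = (if d n = x then 1 else 0)"
  proof (cases "d n = x")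
    case True
    then show ?thesis using order_power_n_n[of x 1] by simp
  next
    case False
    then show ?thesis by (auto intro: order_0I)
  qed
  moreover have "{i. i < Suc n \<and> d i = x} = (if d n = x then insert n {i. i < n \<and> d i = x} else {i. i < n \<and> d i = x})"
    by (auto simp: less_Suc_eq)
  ultimately show ?case
    using Suc order_mult[of "\<Prod>i<n. [:- d i, 1:]" "[:- d n, 1:]" x] nz[of "Suc n"]
    by (simp only: prod.lessThan_Suc) auto
qed

lemma num_negative_eigenvalues_diagonalized:
  fixes A :: "complex mat" and d :: "nat \<Rightarrow> real"
  assumes A: "A \<in> carrier_mat n n" and U: "U \<in> carrier_mat n n"
    and UU: "mat_adjoint U * U = 1\<^sub>m n"
    and AU: "A * U = U * mat n n (\<lambda>(i, j). if i = j then of_real (d i) else 0)"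
  shows "num_negative_eigenvalues A = card {i. i < n \<and> d i < 0}"
proof -
  define D where "D = mat n n (\<lambda>(i, j). if i = j then complex_of_real (d i) else 0)"
  have D: "D \<in> carrier_mat n n" by (simp add: D_def)
  note U' = mat_adjoint_square(1)[OF U]
  have UU': "U * mat_adjoint U = 1\<^sub>m n" using mat_mult_left_right_inverse[OF U' U UU] .
  have "A = U * D * mat_adjoint U"
    using assoc_mult_mat[OF A U U'] AU UU' right_mult_one_mat[OF A] by (simp add: D_def)
  then have "similar_mat_wit A D U (mat_adjoint U)"
    using A U U' D UU UU' by (intro similar_mat_witI[of _ _ n]) auto
  then have "char_poly A = char_poly D"
    by (intro char_poly_similar) (auto simp: similar_mat_def)
  also have "\<dots> = (\<Prod>a\<leftarrow>diag_mat D. [:- a, 1:])"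
    by (rule char_poly_upper_triangular[OF D]) (auto simp: D_def)
  also have "\<dots> = (\<Prod>i<n. [:- complex_of_real (d i), 1:])"
    unfolding diag_mat_def using D
    by (simp add: prod.distinct_set_conv_list[symmetric] atLeast0LessThan o_def)
       (auto simp: D_def intro!: prod.cong)
  finally have cp: "char_poly A = (\<Prod>i<n. [:- complex_of_real (d i), 1:])" .
  have ev: "eigenvalue A (complex_of_real x) \<longleftrightarrow> x \<in> d ` {..<n}" for x
    unfolding eigenvalue_root_char_poly[OF A] cp by (auto simp: poly_prod)
  have ord: "Polynomial.order (complex_of_real x) (char_poly A) = card {i. i < n \<and> d i = x}" for x
    unfolding cp order_prod_linear by simp
  have set: "{x. x < 0 \<and> eigenvalue A (complex_of_real x)} = {x \<in> d ` {..<n}. x < 0}"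
    using ev by auto
  have "card {i. i < n \<and> d i < 0} = card (\<Union>x\<in>{x \<in> d ` {..<n}. x < 0}. {i. i < n \<and> d i = x})"
    by (rule arg_cong[where f = card]) auto
  also have "\<dots> = (\<Sum>x\<in>{x \<in> d ` {..<n}. x < 0}. card {i. i < n \<and> d i = x})"
    by (rule card_UN_disjoint) auto
  finally show ?thesis unfolding num_negative_eigenvalues_def set ord by simp
qed

text \<open>
  A form with at most \<open>k\<close> negative eigenvalues is not negative definite on any family of \<open>k + 1\<close> vectors:
  orthogonality to the eigenvectors of negative eigenvalues amounts to at most \<open>k\<close> linear equations for the
  \<open>k + 1\<close> coefficients, and the form is nonnegative on the orthogonal complement.
\<close>

lemma hermitian_form_nonneg_vector:
  fixes A :: "complex mat" and C :: "nat \<Rightarrow> nat \<Rightarrow> complex"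
  assumes A: "A \<in> carrier_mat n n"
    and herm: "\<And>i j. i < n \<Longrightarrow> j < n \<Longrightarrow> A $$ (i, j) = cnj (A $$ (j, i))"
    and neg: "num_negative_eigenvalues A \<le> k"
  shows "\<exists>y. (\<exists>p\<le>k. y p \<noteq> 0) \<and>
     0 \<le> Re (\<Sum>i<n. \<Sum>j<n. A $$ (i, j) * (\<Sum>p\<le>k. y p * C p i) * cnj (\<Sum>p\<le>k. y p * C p j))"
proof -
  obtain U d where U: "U \<in> carrier_mat n n" and UU: "mat_adjoint U * U = 1\<^sub>m n"
    and AU: "A * U = U * mat n n (\<lambda>(i, j). if i = j then of_real (d i) else 0)"
    using hermitian_diagonalization[OF A herm] by blast
  define D where "D = mat n n (\<lambda>(i, j). if i = j then complex_of_real (d i) else 0)"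
  have D: "D \<in> carrier_mat n n" by (simp add: D_def)
  note U' = mat_adjoint_square[OF U]
  have UU': "U * mat_adjoint U = 1\<^sub>m n" using mat_mult_left_right_inverse[OF U'(1) U UU] .
  have AUD: "A = U * D * mat_adjoint U"
    using assoc_mult_mat[OF A U U'(1)] AU UU' right_mult_one_mat[OF A] by (simp add: D_def)
  have UD: "(U * D) $$ (i, m) = U $$ (i, m) * of_real (d m)" if "i < n" "m < n" for i m
  proof -
    have "(U * D) $$ (i, m) = (\<Sum>k\<in>{0..<n}. U $$ (i, k) * (if k = m then of_real (d k) else 0))"
      using that U D by (auto simp: scalar_prod_def D_def intro!: sum.cong)
    also have "\<dots> = (\<Sum>k\<in>{0..<n}. if k = m then U $$ (i, k) * of_real (d k) else 0)"
      by (intro sum.cong) auto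
    finally show ?thesis using that by simp
  qed
  have Aij: "A $$ (i, j) = (\<Sum>m<n. of_real (d m) * U $$ (i, m) * cnj (U $$ (j, m)))"
    if "i < n" "j < n" for i j
  proof -
    have "(U * D * mat_adjoint U) $$ (i, j) = (\<Sum>m<n. (U * D) $$ (i, m) * mat_adjoint U $$ (m, j))"
      by (rule index_mult_sum[of _ n]) (use that U U'(1) D in auto)
    then show ?thesis
      unfolding AUD using that U'(2)
      by (auto simp: UD mult_ac intro!: sum.cong)
  qed
  let ?N = "{m. m < n \<and> d m < 0}"
  have "card ?N < card {..k}"
    using neg num_negative_eigenvalues_diagonalized[OF A U UU AU] by simp
  then obtain y where y: "\<exists>p\<in>{..k}. y p \<noteq> 0"
    and y0: "\<And>m. m \<in> ?N \<Longrightarrow> (\<Sum>p\<le>k. (\<Sum>i<n. U $$ (i, m) * C p i) * y p) = 0"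
    using homogeneous_system_nontrivial[of ?N "{..k}" "\<lambda>m p. \<Sum>i<n. U $$ (i, m) * C p i"] by auto
  define u where "u = (\<lambda>i. \<Sum>p\<le>k. y p * C p i)"
  define c where "c = (\<lambda>m. \<Sum>i<n. U $$ (i, m) * u i)"
  have c: "c m = 0" if "m \<in> ?N" for m
  proof -
    have "c m = (\<Sum>i<n. \<Sum>p\<le>k. U $$ (i, m) * C p i * y p)"
      unfolding c_def u_def by (simp add: sum_distrib_left mult_ac)
    also have "\<dots> = (\<Sum>p\<le>k. (\<Sum>i<n. U $$ (i, m) * C p i) * y p)"
      by (subst sum.swap) (simp add: sum_distrib_right)
    finally show ?thesis using y0[OF that] by simp
  qed
  have "(\<Sum>i<n. \<Sum>j<n. A $$ (i, j) * u i * cnj (u j))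
      = (\<Sum>i<n. \<Sum>j<n. \<Sum>m<n. of_real (d m) * (U $$ (i, m) * u i) * cnj (U $$ (j, m) * u j))"
    by (intro sum.cong refl) (simp add: Aij sum_distrib_left sum_distrib_right mult_ac)
  also have "\<dots> = (\<Sum>i<n. \<Sum>m<n. \<Sum>j<n. of_real (d m) * (U $$ (i, m) * u i) * cnj (U $$ (j, m) * u j))"
    by (intro sum.cong refl sum.swap)
  also have "\<dots> = (\<Sum>m<n. \<Sum>i<n. \<Sum>j<n. of_real (d m) * (U $$ (i, m) * u i) * cnj (U $$ (j, m) * u j))"
    by (rule sum.swap)
  also have "\<dots> = (\<Sum>m<n. of_real (d m) * (c m * cnj (c m)))"
    unfolding c_def
    by (intro sum.cong refl) (simp only: cnj_sum sum_product sum_distrib_left[symmetric] mult.assoc)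
  also have "\<dots> = of_real (\<Sum>m<n. d m * (cmod (c m))\<^sup>2)"
    by (simp only: complex_norm_square[symmetric] of_real_sum of_real_mult)
  finally have "Re (\<Sum>i<n. \<Sum>j<n. A $$ (i, j) * u i * cnj (u j)) = (\<Sum>m<n. d m * (cmod (c m))\<^sup>2)"
    by simp
  also have "\<dots> \<ge> 0"
  proof (rule sum_nonneg)
    fix m assume "m \<in> {..<n}"
    then show "0 \<le> d m * (cmod (c m))\<^sup>2" using c[of m] by (cases "d m < 0") auto
  qed
  finally show ?thesis using y unfolding u_def by (intro exI[of _ y]) auto
qed

text \<open>
  From here on negative squares enter only through this property, which, unlike the count of eigenvalues, is
  visibly stable under rescaling the kernel and under adding a positive kernel.  The points \<open>z a\<close> may coincide.
\<close>

lemma negative_squares_nonneg_vector: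
  fixes K :: "'a \<Rightarrow> 'a \<Rightarrow> complex" and C :: "nat \<Rightarrow> 'i \<Rightarrow> complex"
  assumes K: "has_negative_squares K \<Omega> q" and q: "q \<le> k"
    and I: "finite I" and z: "\<And>a. a \<in> I \<Longrightarrow> z a \<in> \<Omega>"
  shows "\<exists>y. (\<exists>p\<le>k. y p \<noteq> 0) \<and>
     0 \<le> Re (\<Sum>a\<in>I. \<Sum>b\<in>I. K (z a) (z b) * (\<Sum>p\<le>k. y p * C p a) * cnj (\<Sum>p\<le>k. y p * C p b))"
proof -
  obtain xs where xs: "set xs = I" "distinct xs" using finite_distinct_list[OF I] by blast
  define A where "A = kernel_matrix K (map z xs)"
  have A: "A \<in> carrier_mat (length xs) (length xs)" by (simp add: A_def kernel_matrix_def)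
  have Ai: "A $$ (i, j) = K (z (xs ! i)) (z (xs ! j))" if "i < length xs" "j < length xs" for i j
    using that by (simp add: A_def kernel_matrix_def)
  have "set (map z xs) \<subseteq> \<Omega>" using xs z by auto
  then have neg: "num_negative_eigenvalues A \<le> k"
    using K q unfolding has_negative_squares_def A_def by (meson le_trans)
  have Ksym: "K w w' = cnj (K w' w)" if "w \<in> \<Omega>" "w' \<in> \<Omega>" for w w'
    using K that unfolding has_negative_squares_def by blast
  have herm: "A $$ (i, j) = cnj (A $$ (j, i))" if "i < length xs" "j < length xs" for i j
    unfolding Ai[OF that] Ai[OF that(2,1)] using that xs by (intro Ksym z) auto
  have sum: "(\<Sum>a\<in>I. f a) = (\<Sum>i<length xs. f (xs ! i))" for f :: "'i \<Rightarrow> complex"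
    using sum.reindex_bij_betw[OF bij_betw_nth[OF xs(2) refl xs(1)[symmetric]], of f] by (rule sym)
  have "(\<Sum>i<length xs. \<Sum>j<length xs. K (z (xs ! i)) (z (xs ! j)) * f i * g j)
      = (\<Sum>i<length xs. \<Sum>j<length xs. A $$ (i, j) * f i * g j)" for f g
    by (intro sum.cong refl) (simp add: Ai)
  then show ?thesis
    unfolding sum using hermitian_form_nonneg_vector[OF A herm neg, of "\<lambda>p i. C p (xs ! i)"] by simp
qed

text \<open>
  The negative diagonal \<open>-T\<close> outweighs the perturbation, whose contribution to the form is bounded by the
  crude estimate \<open>c (k + 1)^2\<close> times the squared norm of \<open>y\<close>.
\<close>

lemma dominant_diagonal_negative_definite:
  fixes H :: "nat \<Rightarrow> nat \<Rightarrow> complex" and y :: "nat \<Rightarrow> complex"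
  assumes H: "\<And>p q. p \<le> k \<Longrightarrow> q \<le> k \<Longrightarrow> norm (H p q + (if p = q then of_real T else 0)) \<le> c"
    and T: "c * (real (Suc k))\<^sup>2 < T" and y: "\<exists>p\<le>k. y p \<noteq> 0"
  shows "Re (\<Sum>p\<le>k. \<Sum>q\<le>k. H p q * y p * cnj (y q)) < 0"
proof -
  define Y where "Y = (\<Sum>p\<le>k. (norm (y p))\<^sup>2)"
  have Y: "Y > 0" unfolding Y_def using y by (auto intro!: sum_pos2)
  have Yp: "norm (y p) \<le> sqrt Y" if "p \<le> k" for p
    unfolding Y_def using that by (intro real_le_rsqrt member_le_sum) auto
  have c: "c \<ge> 0" using H[of 0 0] norm_ge_zero order_trans by blast
  define E where "E = (\<lambda>p q. H p q + (if p = q then of_real T else 0))"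
  have "(\<Sum>p\<le>k. \<Sum>q\<le>k. E p q * y p * cnj (y q))
      = (\<Sum>p\<le>k. \<Sum>q\<le>k. H p q * y p * cnj (y q) + (if p = q then of_real T * (y p * cnj (y p)) else 0))"
    by (intro sum.cong refl) (auto simp: E_def algebra_simps)
  also have "\<dots> = (\<Sum>p\<le>k. \<Sum>q\<le>k. H p q * y p * cnj (y q)) + of_real (T * Y)"
    unfolding sum.distrib Y_def
    by (simp add: complex_norm_square[symmetric] sum_distrib_left del: of_real_power)
  finally have "(\<Sum>p\<le>k. \<Sum>q\<le>k. H p q * y p * cnj (y q)) = (\<Sum>p\<le>k. \<Sum>q\<le>k. E p q * y p * cnj (y q)) - of_real (T * Y)"
    by simp
  then have "Re (\<Sum>p\<le>k. \<Sum>q\<le>k. H p q * y p * cnj (y q)) = Re (\<Sum>p\<le>k. \<Sum>q\<le>k. E p q * y p * cnj (y q)) - T * Y"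
    by (simp only: minus_complex.sel Re_complex_of_real)
  also have "\<dots> \<le> norm (\<Sum>p\<le>k. \<Sum>q\<le>k. E p q * y p * cnj (y q)) - T * Y"
    by (intro diff_right_mono complex_Re_le_cmod)
  also have "norm (\<Sum>p\<le>k. \<Sum>q\<le>k. E p q * y p * cnj (y q)) \<le> (\<Sum>p\<le>k. \<Sum>q\<le>k. c * (sqrt Y * sqrt Y))"
  proof (intro order_trans[OF norm_sum] sum_mono)
    fix p q assume "p \<in> {..k}" "q \<in> {..k}"
    then have "norm (E p q) \<le> c" "norm (y p) \<le> sqrt Y" "norm (y q) \<le> sqrt Y"
      using H Yp by (auto simp: E_def)
    then have "norm (E p q) * (norm (y p) * norm (y q)) \<le> c * (sqrt Y * sqrt Y)"
      using c Y by (intro mult_mono) auto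
    then show "norm (E p q * y p * cnj (y q)) \<le> c * (sqrt Y * sqrt Y)" by (simp add: norm_mult mult.assoc)
  qed
  also have "\<dots> = c * (real (Suc k))\<^sup>2 * Y" using Y by (simp add: power2_eq_square)
  also have "c * (real (Suc k))\<^sup>2 * Y - T * Y < 0" using T Y by (simp add: algebra_simps)
  finally show ?thesis by simp
qed

text \<open>
  Gram-Schmidt biorthogonalisation: a new pair is chosen such that its vector annihilates the points found so
  far, and the earlier vectors are corrected by multiples of it in order to annihilate the new point.
\<close>

lemma dual_family:
  fixes a :: "('i \<Rightarrow> complex) \<Rightarrow> 's \<Rightarrow> complex"
  assumes lin: "\<And>x y c s. a (\<lambda>i. x i + c * y i) s = a x s + c * a y s"
    and X: "\<And>x y c. X x \<Longrightarrow> X y \<Longrightarrow> X (\<lambda>i. x i + c * y i)"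
    and step: "\<And>T. finite T \<Longrightarrow> card T < K \<Longrightarrow> T \<subseteq> \<Omega> \<Longrightarrow> \<exists>x s. X x \<and> s \<in> \<Omega> \<and> (\<forall>s'\<in>T. a x s' = 0) \<and> a x s \<noteq> 0"
  shows "m \<le> K \<Longrightarrow> \<exists>x s. (\<forall>p<m. X (x p) \<and> s p \<in> \<Omega>) \<and> (\<forall>p<m. \<forall>q<m. a (x p) (s q) = (if p = q then 1 else 0))"
proof (induction m)
  case 0
  then show ?case by simp
next
  case (Suc m)
  then obtain x s where xs: "\<forall>p<m. X (x p) \<and> s p \<in> \<Omega>"
    and dual: "\<forall>p<m. \<forall>q<m. a (x p) (s q) = (if p = q then 1 else 0)" by auto
  have "card (s ` {..<m}) < K" using card_image_le[of "{..<m}" s] Suc.prems by simp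
  then obtain y r where y: "X y" "r \<in> \<Omega>" "\<And>q. q < m \<Longrightarrow> a y (s q) = 0" "a y r \<noteq> 0"
    using step[of "s ` {..<m}"] xs by (auto simp: image_subset_iff)
  define y' where "y' = (\<lambda>i. y i + (1 / a y r - 1) * y i)"
  have y': "X y'" "\<And>q. q < m \<Longrightarrow> a y' (s q) = 0" "a y' r = 1"
  proof -
    have "a y' s = a y s + (1 / a y r - 1) * a y s" for s unfolding y'_def by (rule lin)
    then have "a y' s = a y s / a y r" for s by (simp add: algebra_simps)
    then show "\<And>q. q < m \<Longrightarrow> a y' (s q) = 0" "a y' r = 1" using y(3,4) by simp_all
    show "X y'" unfolding y'_def by (intro X y)
  qed
  define c where "c = (\<lambda>p. - a (x p) r)"
  have cr: "a (x p) r + c p = 0" for p by (simp add: c_def)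
  define x' where "x' = (\<lambda>p. if p = m then y' else (\<lambda>i. x p i + c p * y' i))"
  define s' where "s' = s(m := r)"
  have "X (x' p) \<and> s' p \<in> \<Omega>" if "p < Suc m" for p
    using that xs X[OF _ y'(1)] y'(1) y(2) by (auto simp: x'_def s'_def less_Suc_eq)
  moreover have "a (x' p) (s' q) = (if p = q then 1 else 0)" if "p < Suc m" "q < Suc m" for p q
    unfolding x'_def s'_def using that y'(2,3) dual by (auto simp: lin less_Suc_eq cr)
  ultimately show ?case by blast
qed

section \<open>Kernels of Blaschke products and of Cayley transforms\<close>

lemma unit_disk_denominator_nonzero:
  fixes a z :: complex
  assumes "norm a < 1" "norm z \<le> 1"
  shows "1 - cnj a * z \<noteq> 0" "1 - a * cnj z \<noteq> 0"
proof -
  have "norm (a * z) < 1" if "norm a < 1" "norm z \<le> 1" for a z :: complex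
    using that mult_mono[of "norm a" "norm a" "norm z" 1] by (simp add: norm_mult)
  then have "norm (cnj a * z) < 1" "norm (a * cnj z) < 1" using assms by simp_all
  then show "1 - cnj a * z \<noteq> 0" "1 - a * cnj z \<noteq> 0" by auto
qed

text \<open>
  Splitting off one factor at a time, with \<open>P\<^sub>k\<close> the product of the first \<open>k\<close> factors and \<open>\<beta>\<close> the next factor,
  \<open>1 - P\<^sub>k \<beta> cnj (P\<^sub>k \<beta>) = (1 - P\<^sub>k cnj P\<^sub>k) + P\<^sub>k cnj P\<^sub>k (1 - \<beta> cnj \<beta>)\<close>, and for a single factor
  \<open>1 - \<beta> cnj \<beta>\<close> is a multiple of \<open>1 - z cnj w\<close>.  The functions \<open>e\<^sub>p\<close> are the Malmquist-Takenaka basis.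
  The extension \<open>B\<close> to the closed disk is needed because \<open>b\<close> is prescribed on the open disk only.
\<close>

lemma blaschke_kernel_decomposition:
  assumes "b \<in> blaschke_products l"
  obtains B e where "B analytic_on cball 0 1" "\<And>p. e p analytic_on cball 0 1"
    "\<And>z. z \<in> ball 0 1 \<Longrightarrow> b z = B z"
    "\<And>z w. z \<in> cball 0 1 \<Longrightarrow> w \<in> cball 0 1 \<Longrightarrow>
        1 - B z * cnj (B w) = (1 - z * cnj w) * (\<Sum>p<l. e p z * cnj (e p w))"
proof -
  obtain c a where c: "norm c = 1" and a0: "\<forall>i<l. a i \<in> ball 0 1"
    and b0: "\<forall>z\<in>ball 0 1. b z = c * (\<Prod>i<l. (z - a i) / (1 - cnj (a i) * z))"
    using assms unfolding blaschke_products_def by blast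
  have a: "norm (a i) < 1" if "i < l" for i using a0 that by auto
  note b = bspec[OF b0]
  define P where "P = (\<lambda>k z. \<Prod>i<k. (z - a i) / (1 - cnj (a i) * z))"
  define e where "e = (\<lambda>p z. if p < l then of_real (sqrt (1 - (norm (a p))\<^sup>2)) * P p z / (1 - cnj (a p) * z) else 0)"
  have nz: "1 - cnj (a i) * z \<noteq> 0" "1 - a i * cnj z \<noteq> 0" if "i < l" "z \<in> cball 0 1" for i z
    using unit_disk_denominator_nonzero[OF a[OF that(1)], of z] that(2) by auto
  have P_analytic: "P k analytic_on cball 0 1" if "k \<le> l" for k
    unfolding P_def by (intro analytic_intros) (use nz that in auto)
  have e_analytic: "e p analytic_on cball 0 1" for p
  proof (cases "p < l")
    case True
    then have "(\<lambda>z. of_real (sqrt (1 - (norm (a p))\<^sup>2)) * P p z / (1 - cnj (a p) * z)) analytic_on cball 0 1"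
      using nz P_analytic[of p] by (intro analytic_intros) auto
    then show ?thesis using True by (simp add: e_def)
  qed (simp add: e_def)
  have decomp: "1 - P k z * cnj (P k w) = (1 - z * cnj w) * (\<Sum>p<k. e p z * cnj (e p w))"
    if z: "z \<in> cball 0 1" and w: "w \<in> cball 0 1" and "k \<le> l" for k z w
    using \<open>k \<le> l\<close>
  proof (induction k)
    case 0
    then show ?case by (simp add: P_def)
  next
    case (Suc k)
    then have k: "k < l" by simp
    define dz where "dz = 1 - cnj (a k) * z"
    define dw where "dw = 1 - a k * cnj w"
    have d: "dz \<noteq> 0" "dw \<noteq> 0" using nz[OF k z] nz[OF k w] by (simp_all add: dz_def dw_def)
    have PS: "P (Suc k) z = P k z * ((z - a k) / dz)" "cnj (P (Suc k) w) = cnj (P k w) * ((cnj w - cnj (a k)) / dw)"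
      by (simp_all add: P_def dz_def dw_def)
    have sq: "complex_of_real (sqrt (1 - (norm (a k))\<^sup>2)) * complex_of_real (sqrt (1 - (norm (a k))\<^sup>2)) = 1 - a k * cnj (a k)"
    proof -
      have "(norm (a k))\<^sup>2 \<le> 1" using a[OF k] by (simp add: power_le_one)
      then have "complex_of_real (sqrt (1 - (norm (a k))\<^sup>2)) * complex_of_real (sqrt (1 - (norm (a k))\<^sup>2))
         = of_real (1 - (norm (a k))\<^sup>2)"
        by (simp add: of_real_mult[symmetric] del: of_real_mult)
      then show ?thesis using complex_norm_square[of "a k"] by simp
    qed
    have ee: "e k z * cnj (e k w) = (1 - a k * cnj (a k)) * (P k z * cnj (P k w)) / (dz * dw)"
      unfolding sq[symmetric] using k by (simp add: e_def dz_def dw_def)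
    have key: "dz * dw - (z - a k) * (cnj w - cnj (a k)) = (1 - a k * cnj (a k)) * (1 - z * cnj w)"
      by (simp add: dz_def dw_def algebra_simps)
    have "1 - P (Suc k) z * cnj (P (Suc k) w)
        = (1 - P k z * cnj (P k w)) + P k z * cnj (P k w) * (dz * dw - (z - a k) * (cnj w - cnj (a k))) / (dz * dw)"
      unfolding PS using d by (simp add: field_simps)
    also have "\<dots> = (1 - z * cnj w) * (\<Sum>p<Suc k. e p z * cnj (e p w))"
      unfolding key using Suc k ee by (simp add: algebra_simps)
    finally show ?case .
  qed
  have "c * cnj c = 1" using c by (metis complex_norm_square of_real_1 one_power2)
  then have cc: "c * x * (cnj c * y) = x * y" for x y
    by (metis mult.assoc mult.commute mult_1)
  show thesis
  proof (rule that[of "\<lambda>z. c * P l z" e])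
    show "(\<lambda>z. c * P l z) analytic_on cball 0 1"
      by (intro analytic_intros P_analytic) simp
    show "b z = c * P l z" if "z \<in> ball 0 1" for z
      using b[OF that] by (simp add: P_def)
    show "1 - c * P l z * cnj (c * P l w) = (1 - z * cnj w) * (\<Sum>p<l. e p z * cnj (e p w))"
      if "z \<in> cball 0 1" "w \<in> cball 0 1" for z w
      using decomp[OF that, of l] by (simp only: complex_cnj_mult cc order_refl simp_thms)
  qed (rule e_analytic)
qed

lemma contractive_from_kernel:
  fixes B :: "complex \<Rightarrow> complex"
  assumes B: "1 - B z * cnj (B z) = (1 - z * cnj z) * (\<Sum>p<l. e p z * cnj (e p z))" and z: "z \<in> ball 0 1"
  shows "norm (B z) \<le> 1"
proof -
  have "1 - complex_of_real ((norm (B z))\<^sup>2) = of_real ((1 - (norm z)\<^sup>2) * (\<Sum>p<l. (norm (e p z))\<^sup>2))"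
    using B by (simp only: complex_norm_square of_real_mult of_real_diff of_real_1 of_real_sum)
  then have "complex_of_real (1 - (norm (B z))\<^sup>2) = of_real ((1 - (norm z)\<^sup>2) * (\<Sum>p<l. (norm (e p z))\<^sup>2))"
    by simp
  then have "1 - (norm (B z))\<^sup>2 = (1 - (norm z)\<^sup>2) * (\<Sum>p<l. (norm (e p z))\<^sup>2)"
    by (simp only: of_real_eq_iff)
  also have "\<dots> \<ge> 0" using z by (intro mult_nonneg_nonneg sum_nonneg) (auto simp: power_le_one)
  finally have "(norm (B z))\<^sup>2 \<le> 1" by simp
  then show ?thesis by (simp add: power2_le_iff_abs_le abs_square_le_1)
qed

lemma sum_swap_pairs:
  fixes f :: "'a \<Rightarrow> 'b \<Rightarrow> 'c \<Rightarrow> 'd \<Rightarrow> 'e::comm_monoid_add"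
  shows "(\<Sum>a\<in>A. \<Sum>b\<in>B. \<Sum>c\<in>C. \<Sum>d\<in>D. f a b c d) = (\<Sum>c\<in>C. \<Sum>d\<in>D. \<Sum>a\<in>A. \<Sum>b\<in>B. f a b c d)"
proof -
  have inner: "(\<Sum>b\<in>B. \<Sum>c\<in>C. \<Sum>d\<in>D. f a b c d) = (\<Sum>c\<in>C. \<Sum>d\<in>D. \<Sum>b\<in>B. f a b c d)" for a
    by (subst sum.swap) (intro sum.cong refl sum.swap)
  have "(\<Sum>a\<in>A. \<Sum>c\<in>C. \<Sum>d\<in>D. g a c d) = (\<Sum>c\<in>C. \<Sum>d\<in>D. \<Sum>a\<in>A. g a c d)" for g :: "'a \<Rightarrow> 'c \<Rightarrow> 'd \<Rightarrow> 'e"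
    by (subst sum.swap) (intro sum.cong refl sum.swap)
  then show ?thesis unfolding inner .
qed

text \<open>
  The kernel \<open>M\<close> is the kernel \<open>S\<^sub>\<phi>\<close> with the denominators \<open>h + 1\<close> of \<open>\<phi> = b (h - 1) / (h + 1)\<close> cleared, so
  that points with \<open>h = -1\<close> need no exception.  It equals \<open>2 b cnj b\<close> times the Caratheodory kernel plus
  \<open>(h + 1) cnj (h + 1)\<close> times the kernel of \<open>b\<close>.  The coefficients \<open>y\<close> that make the first part nonnegative come
  from the vectors \<open>C\<close> multiplied by \<open>b\<close>; the second part is a sum of squares.
\<close>

lemma cayley_kernel_nonneg_vector:
  fixes h b :: "complex \<Rightarrow> complex" and C :: "nat \<Rightarrow> 'i \<Rightarrow> complex"
  assumes h: "has_negative_squares (caratheodory_kernel h) \<Omega> q" "q \<le> k"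
    and \<Omega>: "\<Omega> \<subseteq> ball 0 1"
    and b: "\<And>z w. z \<in> ball 0 1 \<Longrightarrow> w \<in> ball 0 1 \<Longrightarrow>
        1 - b z * cnj (b w) = (1 - z * cnj w) * (\<Sum>p<r. e p z * cnj (e p w))"
    and I: "finite I" and z: "\<And>a. a \<in> I \<Longrightarrow> z a \<in> \<Omega>"
  defines "M \<equiv> \<lambda>z w. ((h z + 1) * cnj (h w + 1) - b z * (h z - 1) * cnj (b w * (h w - 1))) / (1 - z * cnj w)"
  shows "\<exists>y. (\<exists>p\<le>k. y p \<noteq> 0) \<and>
     0 \<le> Re (\<Sum>a\<in>I. \<Sum>c\<in>I. M (z a) (z c) * (\<Sum>p\<le>k. y p * C p a) * cnj (\<Sum>p\<le>k. y p * C p c))"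
proof -
  have "\<exists>y. (\<exists>p\<le>k. y p \<noteq> 0) \<and>
      0 \<le> Re (\<Sum>a\<in>I. \<Sum>c\<in>I. caratheodory_kernel h (z a) (z c) *
        (\<Sum>p\<le>k. y p * (b (z a) * C p a)) * cnj (\<Sum>p\<le>k. y p * (b (z c) * C p c)))"
    by (rule negative_squares_nonneg_vector[where C = "\<lambda>p a. b (z a) * C p a", OF h I]) (rule z)
  then obtain y where y: "\<exists>p\<le>k. y p \<noteq> 0"
    and pos: "0 \<le> Re (\<Sum>a\<in>I. \<Sum>c\<in>I. caratheodory_kernel h (z a) (z c) *
        (\<Sum>p\<le>k. y p * (b (z a) * C p a)) * cnj (\<Sum>p\<le>k. y p * (b (z c) * C p c)))"
    by (rule exE) (erule conjE, rule that)
  define u where "u = (\<lambda>a. \<Sum>p\<le>k. y p * C p a)"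
  have u: "(\<Sum>p\<le>k. y p * (b (z a) * C p a)) = b (z a) * u a" for a
    unfolding u_def sum_distrib_left by (intro sum.cong) (auto simp: mult_ac)
  define v where "v = (\<lambda>p. \<Sum>a\<in>I. e p (z a) * (h (z a) + 1) * u a)"
  \<comment> \<open>The two parts of the kernel, the second written as a sum of squares.\<close>
  have M: "M (z a) (z c) * u a * cnj (u c) = 2 * (caratheodory_kernel h (z a) (z c) * (b (z a) * u a) * cnj (b (z c) * u c))
     + (\<Sum>p<r. (e p (z a) * (h (z a) + 1) * u a) * cnj (e p (z c) * (h (z c) + 1) * u c))" if "a \<in> I" "c \<in> I" for a c
  proof -
    have za: "z a \<in> ball 0 1" "z c \<in> ball 0 1" using subsetD[OF \<Omega> z[OF that(1)]] subsetD[OF \<Omega> z[OF that(2)]] .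
    then have nz: "1 - z a * cnj (z c) \<noteq> 0" using unit_disk_denominator_nonzero(2)[of "z a" "z c"] by simp
    have "M (z a) (z c) = (2 * (b (z a) * cnj (b (z c))) * (h (z a) + cnj (h (z c)))
        + (h (z a) + 1) * cnj (h (z c) + 1) * (1 - b (z a) * cnj (b (z c)))) / (1 - z a * cnj (z c))"
      unfolding M_def by (rule arg_cong[where f = "\<lambda>x. x / _"]) (simp add: algebra_simps)
    also have "\<dots> = 2 * (b (z a) * cnj (b (z c))) * caratheodory_kernel h (z a) (z c)
        + (h (z a) + 1) * cnj (h (z c) + 1) * (\<Sum>p<r. e p (z a) * cnj (e p (z c)))"
    proof -
      have "(P * X + Q * (D * S)) / D = P * (X / D) + Q * S" if "D \<noteq> 0" for P X Q D S :: complex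
        using that by (simp add: field_simps)
      from this[OF nz] show ?thesis unfolding b[OF za] caratheodory_kernel_def .
    qed
    finally show ?thesis
      by (simp add: algebra_simps sum_distrib_left sum_distrib_right)
  qed
  have "(\<Sum>a\<in>I. \<Sum>c\<in>I. M (z a) (z c) * u a * cnj (u c))
      = 2 * (\<Sum>a\<in>I. \<Sum>c\<in>I. caratheodory_kernel h (z a) (z c) * (b (z a) * u a) * cnj (b (z c) * u c))
       + (\<Sum>a\<in>I. \<Sum>c\<in>I. \<Sum>p<r. (e p (z a) * (h (z a) + 1) * u a) * cnj (e p (z c) * (h (z c) + 1) * u c))"
    by (simp only: M sum.distrib sum_distrib_left cong: sum.cong)
  also have "(\<Sum>a\<in>I. \<Sum>c\<in>I. \<Sum>p<r. (e p (z a) * (h (z a) + 1) * u a) * cnj (e p (z c) * (h (z c) + 1) * u c))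
      = (\<Sum>a\<in>I. \<Sum>p<r. \<Sum>c\<in>I. (e p (z a) * (h (z a) + 1) * u a) * cnj (e p (z c) * (h (z c) + 1) * u c))"
    by (intro sum.cong refl sum.swap)
  also have "\<dots> = (\<Sum>p<r. \<Sum>a\<in>I. \<Sum>c\<in>I. (e p (z a) * (h (z a) + 1) * u a) * cnj (e p (z c) * (h (z c) + 1) * u c))"
    by (rule sum.swap)
  also have "\<dots> = (\<Sum>p<r. v p * cnj (v p))"
    unfolding v_def by (simp only: cnj_sum sum_product)
  also have "\<dots> = of_real (\<Sum>p<r. (norm (v p))\<^sup>2)"
    by (simp only: complex_norm_square[symmetric] of_real_sum)
  finally have eq: "(\<Sum>a\<in>I. \<Sum>c\<in>I. M (z a) (z c) * u a * cnj (u c))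
      = 2 * (\<Sum>a\<in>I. \<Sum>c\<in>I. caratheodory_kernel h (z a) (z c) * (b (z a) * u a) * cnj (b (z c) * u c))
       + of_real (\<Sum>p<r. (norm (v p))\<^sup>2)" .
  have "0 \<le> Re (2 * X + of_real (\<Sum>p<r. (norm (v p))\<^sup>2))" if "0 \<le> Re X" for X
    using that by (simp add: sum_nonneg)
  then have "0 \<le> Re (\<Sum>a\<in>I. \<Sum>c\<in>I. M (z a) (z c) * u a * cnj (u c))"
    unfolding eq using pos unfolding u by blast
  then show ?thesis using y unfolding u_def by blast
qed

lemma cayley_gram_matrix_not_negative:
  fixes h b :: "complex \<Rightarrow> complex" and C :: "nat \<Rightarrow> 'i \<Rightarrow> complex"
  assumes h: "has_negative_squares (caratheodory_kernel h) \<Omega> q" "q \<le> k"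
    and \<Omega>: "\<Omega> \<subseteq> ball 0 1"
    and b: "\<And>z w. z \<in> ball 0 1 \<Longrightarrow> w \<in> ball 0 1 \<Longrightarrow>
        1 - b z * cnj (b w) = (1 - z * cnj w) * (\<Sum>p<r. e p z * cnj (e p w))"
    and I: "finite I" and z: "\<And>a. a \<in> I \<Longrightarrow> z a \<in> \<Omega>"
    and T: "c * (real (Suc k))\<^sup>2 < T"
  defines "M \<equiv> \<lambda>z w. ((h z + 1) * cnj (h w + 1) - b z * (h z - 1) * cnj (b w * (h w - 1))) / (1 - z * cnj w)"
  shows "\<exists>p\<le>k. \<exists>q\<le>k. norm ((\<Sum>a\<in>I. \<Sum>d\<in>I. M (z a) (z d) * C p a * cnj (C q d)) + (if p = q then of_real T else 0)) > c"
proof (rule ccontr)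
  define H where "H = (\<lambda>p q. \<Sum>a\<in>I. \<Sum>d\<in>I. M (z a) (z d) * C p a * cnj (C q d))"
  assume "\<not> ?thesis"
  then have H: "norm (H p q + (if p = q then of_real T else 0)) \<le> c" if "p \<le> k" "q \<le> k" for p q
    using that unfolding H_def by (meson not_le)
  have "\<exists>y. (\<exists>p\<le>k. y p \<noteq> 0) \<and>
      0 \<le> Re (\<Sum>a\<in>I. \<Sum>d\<in>I. M (z a) (z d) * (\<Sum>p\<le>k. y p * C p a) * cnj (\<Sum>p\<le>k. y p * C p d))"
    unfolding M_def by (rule cayley_kernel_nonneg_vector[where C = C, OF h \<Omega> _ I]) (fact b, fact z)
  then obtain y where y: "\<exists>p\<le>k. y p \<noteq> 0"
    and pos: "0 \<le> Re (\<Sum>a\<in>I. \<Sum>d\<in>I. M (z a) (z d) * (\<Sum>p\<le>k. y p * C p a) * cnj (\<Sum>p\<le>k. y p * C p d))"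
    by (rule exE) (erule conjE, rule that)
  have "(\<Sum>a\<in>I. \<Sum>d\<in>I. M (z a) (z d) * (\<Sum>p\<le>k. y p * C p a) * cnj (\<Sum>p\<le>k. y p * C p d))
      = (\<Sum>a\<in>I. \<Sum>d\<in>I. \<Sum>p\<le>k. \<Sum>q\<le>k. M (z a) (z d) * C p a * cnj (C q d) * y p * cnj (y q))"
  proof (intro sum.cong refl)
    fix a d
    have "M (z a) (z d) * (\<Sum>p\<le>k. y p * C p a) * cnj (\<Sum>p\<le>k. y p * C p d)
        = M (z a) (z d) * ((\<Sum>p\<le>k. y p * C p a) * (\<Sum>q\<le>k. cnj (y q * C q d)))"
      by (simp only: cnj_sum mult.assoc)
    also have "\<dots> = (\<Sum>p\<le>k. \<Sum>q\<le>k. M (z a) (z d) * C p a * cnj (C q d) * y p * cnj (y q))"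
      unfolding sum_product unfolding sum_distrib_left
      by (intro sum.cong refl) (simp only: complex_cnj_mult mult_ac)
    finally show "M (z a) (z d) * (\<Sum>p\<le>k. y p * C p a) * cnj (\<Sum>p\<le>k. y p * C p d)
        = (\<Sum>p\<le>k. \<Sum>q\<le>k. M (z a) (z d) * C p a * cnj (C q d) * y p * cnj (y q))" .
  qed
  also have "\<dots> = (\<Sum>p\<le>k. \<Sum>q\<le>k. \<Sum>a\<in>I. \<Sum>d\<in>I. M (z a) (z d) * C p a * cnj (C q d) * y p * cnj (y q))"
    by (rule sum_swap_pairs)
  also have "\<dots> = (\<Sum>p\<le>k. \<Sum>q\<le>k. H p q * y p * cnj (y q))"
    by (simp only: H_def sum_distrib_right)
  finally show False
    using pos dominant_diagonal_negative_definite[of k H T c y, OF H T y] by simp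
qed

section \<open>Divided differences\<close>

text \<open>
  The weights of the divided difference of order \<open>k\<close> at \<open>1, ..., k + 1\<close>.  Any nonzero solution of the first \<open>k\<close>
  equations will do after scaling: if it also annihilated the power \<open>k\<close>, it would annihilate the polynomials that
  vanish at all nodes but one.
\<close>

lemma divided_difference_weights:
  "\<exists>\<alpha> :: nat \<Rightarrow> complex. \<forall>q\<le>k. (\<Sum>j\<le>k. \<alpha> j * of_nat (Suc j) ^ q) = (if q = k then 1 else 0)"
proof -
  let ?c = "\<lambda>j. of_nat (Suc j) :: complex"
  obtain \<beta> where nz: "\<exists>j\<in>{..k}. \<beta> j \<noteq> 0" and \<beta>: "\<forall>q\<in>{..<k}. (\<Sum>j\<le>k. ?c j ^ q * \<beta> j) = 0"
    using homogeneous_system_nontrivial[of "{..<k}" "{..k}" "\<lambda>q j. ?c j ^ q"] by auto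
  define S where "S = (\<Sum>j\<le>k. ?c j ^ k * \<beta> j)"
  have "S \<noteq> 0"
  proof
    assume "S = 0"
    with \<beta> have 0: "(\<Sum>j\<le>k. ?c j ^ q * \<beta> j) = 0" if "q \<le> k" for q
      using that by (cases "q = k") (auto simp: S_def simp del: of_nat_Suc)
    obtain j0 where j0: "j0 \<le> k" "\<beta> j0 \<noteq> 0" using nz by auto
    define p where "p = (\<Prod>i\<in>{..k} - {j0}. [:- ?c i, 1:])"
    have "degree p \<le> (\<Sum>i\<in>{..k} - {j0}. degree [:- ?c i, 1:])"
      using degree_prod_sum_le[of "{..k} - {j0}" "\<lambda>i. [:- ?c i, 1:]"] by (simp add: p_def o_def)
    also have "\<dots> = k" using j0 by (simp del: of_nat_Suc)
    finally have deg: "degree p \<le> k" .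
    have "(\<Sum>j\<le>k. poly p (?c j) * \<beta> j) = (\<Sum>j\<le>k. \<Sum>q\<le>degree p. coeff p q * (?c j ^ q * \<beta> j))"
      by (simp only: poly_altdef sum_distrib_right mult.assoc)
    also have "\<dots> = (\<Sum>q\<le>degree p. coeff p q * (\<Sum>j\<le>k. ?c j ^ q * \<beta> j))"
      unfolding sum_distrib_left by (rule sum.swap)
    also have "\<dots> = 0" using 0 deg by (intro sum.neutral ballI) (simp del: of_nat_Suc)
    also have "(\<Sum>j\<le>k. poly p (?c j) * \<beta> j) = (\<Sum>j\<in>{j0}. poly p (?c j) * \<beta> j)"
      by (rule sum.mono_neutral_right) (use j0 in \<open>auto simp: p_def poly_prod simp del: of_nat_Suc\<close>)
    finally have "poly p (?c j0) = 0" using j0 by simp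
    then show False by (auto simp: p_def poly_prod simp del: of_nat_Suc)
  qed
  have "(\<Sum>j\<le>k. \<beta> j / S * ?c j ^ q) = (\<Sum>j\<le>k. ?c j ^ q * \<beta> j) / S" for q
    unfolding sum_divide_distrib by (intro sum.cong) (auto simp: mult_ac)
  with \<beta> \<open>S \<noteq> 0\<close> show ?thesis
    by (intro exI[of _ "\<lambda>j. \<beta> j / S"]) (auto simp: S_def simp del: of_nat_Suc)
qed

text \<open>
  The weights remove the Taylor coefficients below order \<open>k\<close> exactly, and the remainder is of order
  \<open>\<epsilon>^(k + 1)\<close> against the denominator \<open>\<epsilon>^k\<close>.
\<close>

lemma divided_difference_tendsto:
  fixes \<alpha> a :: "nat \<Rightarrow> complex" and F :: "complex \<Rightarrow> complex" and \<epsilon> :: "nat \<Rightarrow> real"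
  assumes \<alpha>: "\<And>q. q \<le> k \<Longrightarrow> (\<Sum>j\<le>k. \<alpha> j * of_nat (Suc j) ^ q) = (if q = k then 1 else 0)"
    and F: "eventually (\<lambda>s. norm (F s - (\<Sum>q\<le>k. a q * s ^ q)) \<le> C * norm s ^ Suc k) (nhds 0)"
    and \<epsilon>: "\<epsilon> \<longlonglongrightarrow> 0" "\<And>s. \<epsilon> s > 0"
  shows "(\<lambda>s. (\<Sum>j\<le>k. \<alpha> j * F (of_real (\<epsilon> s) * of_nat (Suc j))) / of_real (\<epsilon> s) ^ k) \<longlonglongrightarrow> a k"
proof -
  define R where "R = (\<lambda>z. F z - (\<Sum>q\<le>k. a q * z ^ q))"
  define z where "z = (\<lambda>s j. complex_of_real (\<epsilon> s) * of_nat (Suc j))"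
  have z0: "(\<lambda>s. z s j) \<longlonglongrightarrow> 0" for j
    unfolding z_def using tendsto_mult_right[OF tendsto_of_real[OF \<epsilon>(1)], of "of_nat (Suc j)"] by simp
  have R0: "(\<lambda>s. \<alpha> j * R (z s j) / of_real (\<epsilon> s) ^ k) \<longlonglongrightarrow> 0" for j
  proof (rule Lim_null_comparison)
    have "eventually (\<lambda>s. norm (R (z s j)) \<le> C * norm (z s j) ^ Suc k) sequentially"
      using eventually_compose_filterlim[OF F z0[of j]] unfolding R_def .
    then show "eventually (\<lambda>s. norm (\<alpha> j * R (z s j) / of_real (\<epsilon> s) ^ k)
        \<le> norm (\<alpha> j) * C * real (Suc j) ^ Suc k * \<epsilon> s) sequentially"
    proof eventually_elim
      case (elim s)
      have nz: "norm (z s j) = \<epsilon> s * real (Suc j)"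
        using \<epsilon>(2)[of s] by (simp only: z_def norm_mult norm_of_real norm_of_nat abs_of_pos)
      have "norm (\<alpha> j * R (z s j) / of_real (\<epsilon> s) ^ k) = norm (\<alpha> j) * norm (R (z s j)) / \<epsilon> s ^ k"
        using \<epsilon>(2)[of s] by (simp add: norm_mult norm_divide norm_power)
      also have "\<dots> \<le> norm (\<alpha> j) * (C * (\<epsilon> s * real (Suc j)) ^ Suc k) / \<epsilon> s ^ k"
        using elim \<epsilon>(2)[of s] unfolding nz by (intro divide_right_mono mult_left_mono) auto
      also have "\<dots> = norm (\<alpha> j) * C * real (Suc j) ^ Suc k * \<epsilon> s"
        using \<epsilon>(2)[of s] by (simp add: power_mult_distrib field_simps del: of_nat_Suc)
      finally show ?case .
    qed
    show "(\<lambda>s. norm (\<alpha> j) * C * real (Suc j) ^ Suc k * \<epsilon> s) \<longlonglongrightarrow> 0"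
      by (rule tendsto_mult_right_zero[OF \<epsilon>(1)])
  qed
  have "(\<Sum>j\<le>k. \<alpha> j * F (z s j)) / of_real (\<epsilon> s) ^ k
      = a k + (\<Sum>j\<le>k. \<alpha> j * R (z s j) / of_real (\<epsilon> s) ^ k)" for s
  proof -
    have "(\<Sum>j\<le>k. \<alpha> j * F (z s j)) = (\<Sum>j\<le>k. \<Sum>q\<le>k. a q * of_real (\<epsilon> s) ^ q * (\<alpha> j * of_nat (Suc j) ^ q))
        + (\<Sum>j\<le>k. \<alpha> j * R (z s j))"
      unfolding sum.distrib[symmetric]
    proof (intro sum.cong refl)
      fix j
      have "\<alpha> j * F (z s j) = \<alpha> j * (\<Sum>q\<le>k. a q * z s j ^ q) + \<alpha> j * R (z s j)"
        by (simp add: R_def algebra_simps)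
      also have "\<alpha> j * (\<Sum>q\<le>k. a q * z s j ^ q) = (\<Sum>q\<le>k. a q * of_real (\<epsilon> s) ^ q * (\<alpha> j * of_nat (Suc j) ^ q))"
        unfolding sum_distrib_left z_def power_mult_distrib by (intro sum.cong refl) (simp only: mult_ac)
      finally show "\<alpha> j * F (z s j) = (\<Sum>q\<le>k. a q * of_real (\<epsilon> s) ^ q * (\<alpha> j * of_nat (Suc j) ^ q)) + \<alpha> j * R (z s j)" .
    qed
    also have "(\<Sum>j\<le>k. \<Sum>q\<le>k. a q * of_real (\<epsilon> s) ^ q * (\<alpha> j * of_nat (Suc j) ^ q))
        = (\<Sum>q\<le>k. a q * of_real (\<epsilon> s) ^ q * (\<Sum>j\<le>k. \<alpha> j * of_nat (Suc j) ^ q))"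
      unfolding sum_distrib_left by (rule sum.swap)
    also have "\<dots> = (\<Sum>q\<le>k. if q = k then a k * of_real (\<epsilon> s) ^ k else 0)"
      by (intro sum.cong refl) (use \<alpha> in auto)
    also have "\<dots> = a k * of_real (\<epsilon> s) ^ k" by simp
    finally show ?thesis using \<epsilon>(2)[of s] by (simp add: add_divide_distrib sum_divide_distrib)
  qed
  moreover have "(\<lambda>s. a k + (\<Sum>j\<le>k. \<alpha> j * R (z s j) / of_real (\<epsilon> s) ^ k)) \<longlonglongrightarrow> a k + 0"
    by (intro tendsto_add tendsto_const tendsto_null_sum R0)
  ultimately show ?thesis by (simp add: z_def)
qed

lemma analytic_taylor_bound:
  fixes F :: "complex \<Rightarrow> complex"
  assumes "F analytic_on {0}"
  shows "\<exists>a C. eventually (\<lambda>s. norm (F s - (\<Sum>q\<le>k. a q * s ^ q)) \<le> C * norm s ^ Suc k) (nhds 0)"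
proof -
  obtain r where r: "r > 0" "F holomorphic_on ball 0 r"
    using assms by (meson analytic_on_def singletonI)
  define S where "S = cball (0::complex) (r / 2)"
  have S: "S \<subseteq> ball 0 r" using r(1) by (auto simp: S_def)
  have hol: "(deriv ^^ i) F holomorphic_on ball 0 r" for i
    using r by (intro holomorphic_higher_deriv) auto
  have "continuous_on S ((deriv ^^ Suc k) F)"
    using hol S by (meson continuous_on_subset holomorphic_on_imp_continuous_on)
  then have "bounded ((deriv ^^ Suc k) F ` S)"
    by (intro compact_imp_bounded compact_continuous_image) (auto simp: S_def)
  then obtain M where M: "\<And>x. x \<in> S \<Longrightarrow> norm ((deriv ^^ Suc k) F x) \<le> M"
    unfolding bounded_iff by (metis imageI)
  have der: "((deriv ^^ i) F has_field_derivative (deriv ^^ Suc i) F x) (at x within S)" if "x \<in> S" for i x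
    using holomorphic_derivI[OF hol[of i] open_ball, of x S] S that by auto
  have "norm (F s - (\<Sum>q\<le>k. (deriv ^^ q) F 0 / fact q * s ^ q)) \<le> M / fact k * norm s ^ Suc k" if "s \<in> S" for s
    using complex_Taylor[of S k "\<lambda>i. (deriv ^^ i) F" M 0 s] M der that r(1) by (auto simp: S_def)
  moreover have "eventually (\<lambda>s. s \<in> S) (nhds 0)"
    using eventually_nhds_in_open[of "ball 0 (r/2)" 0] r(1)
    by (auto simp: S_def elim: eventually_mono)
  ultimately show ?thesis
    by (intro exI[of _ "\<lambda>q. (deriv ^^ q) F 0 / fact q"] exI[of _ "M / fact k"]) (auto elim: eventually_mono)
qed

text \<open>
  For the resolvent the Taylor coefficients are needed in closed form, which the finite geometric series gives.
\<close>

lemma geometric_taylor_bound: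
  fixes c d :: complex
  assumes "c \<noteq> 0"
  shows "\<exists>C. eventually (\<lambda>s. norm (1 / (c + d * s) - (\<Sum>q\<le>k. (- d) ^ q / c ^ Suc q * s ^ q)) \<le> C * norm s ^ Suc k) (nhds 0)"
proof -
  have "((\<lambda>s. c + d * s) \<longlongrightarrow> c + d * 0) (nhds 0)" by (intro tendsto_intros filterlim_ident)
  then have "eventually (\<lambda>s. dist (c + d * s) c < norm c / 2) (nhds 0)"
    using assms by (intro tendstoD) auto
  then have "eventually (\<lambda>s. norm (1 / (c + d * s) - (\<Sum>q\<le>k. (- d) ^ q / c ^ Suc q * s ^ q))
      \<le> (norm (d / c) ^ Suc k * (2 / norm c)) * norm s ^ Suc k) (nhds 0)"
  proof eventually_elim
    case (elim s)
    have "norm c \<le> norm (c + d * s) + norm (d * s)" by (metis add_diff_cancel_right' norm_triangle_ineq4)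
    then have n: "norm (c + d * s) \<ge> norm c / 2" using elim by (simp add: dist_norm)
    then have nz: "c + d * s \<noteq> 0" using assms by auto
    define x where "x = (- d) * s / c"
    have "(\<Sum>q\<le>k. (- d) ^ q / c ^ Suc q * s ^ q) = (\<Sum>q\<le>k. x ^ q) / c"
      unfolding sum_divide_distrib x_def power_mult_distrib power_divide
      by (intro sum.cong refl) simp
    moreover have cx: "c + d * s = c * (1 - x)" using assms by (simp add: x_def field_simps)
    moreover have "1 / (c * (1 - x)) - G / c = (1 - (1 - x) * G) / (c * (1 - x))" for G
      using nz assms unfolding cx by (simp add: divide_simps)
    ultimately have "1 / (c + d * s) - (\<Sum>q\<le>k. (- d) ^ q / c ^ Suc q * s ^ q)
        = (1 - (1 - x) * (\<Sum>q\<le>k. x ^ q)) / (c + d * s)" by simp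
    also have "\<dots> = x ^ Suc k / (c + d * s)" unfolding sum_gp_basic by simp
    finally have "1 / (c + d * s) - (\<Sum>q\<le>k. (- d) ^ q / c ^ Suc q * s ^ q) = x ^ Suc k / (c + d * s)" .
    then have "norm (1 / (c + d * s) - (\<Sum>q\<le>k. (- d) ^ q / c ^ Suc q * s ^ q)) = norm (d / c) ^ Suc k * norm s ^ Suc k / norm (c + d * s)"
      by (simp only: x_def norm_mult norm_divide norm_power norm_minus_cancel power_mult_distrib power_divide) simp
    also have "\<dots> \<le> norm (d / c) ^ Suc k * norm s ^ Suc k / (norm c / 2)"
      using n assms by (intro divide_left_mono mult_pos_pos) auto
    finally show ?case by (simp add: field_simps)
  qed
  then show ?thesis by blast
qed

section \<open>Boundary functionals\<close>

text \<open>
  The boundary functionals are approximated along a sequence \<open>\<eta>\<close> that tends to \<open>0\<close>.  The number of nodes on the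
  radius to \<open>t i\<close> is \<open>N i\<close>, and \<open>\<alpha> k\<close> are the weights of the divided difference of order \<open>k\<close>.
\<close>

locale boundary_nodes =
  fixes A :: "nat set" and t :: "nat \<Rightarrow> complex" and N :: "nat \<Rightarrow> nat"
    and \<eta> :: "nat \<Rightarrow> real" and \<alpha> :: "nat \<Rightarrow> nat \<Rightarrow> complex"
  assumes finite_A: "finite A"
    and unimodular: "\<And>i. i \<in> A \<Longrightarrow> norm (t i) = 1"
    and \<eta>_pos: "\<And>s. 0 < \<eta> s" and \<eta>_le: "\<And>s. \<eta> s \<le> 1" and \<eta>_lim: "\<eta> \<longlonglongrightarrow> 0"
    and \<alpha>: "\<And>k q. q \<le> k \<Longrightarrow> (\<Sum>j\<le>k. \<alpha> k j * of_nat (Suc j) ^ q) = (if q = k then 1 else 0)"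
begin

text \<open>
  With this choice \<open>step i s ^ N i = \<eta> s\<close> whenever \<open>0 < N i\<close>, so that errors at nodes on different radii can be
  compared with powers of the same \<open>\<eta> s\<close>.
\<close>

definition step :: "nat \<Rightarrow> nat \<Rightarrow> real" where
  "step i s = root (N i) (\<eta> s)"

text \<open>
  A pair \<open>(i, k)\<close> stands for the derivative of order \<open>k\<close> at \<open>t i\<close> and also for the node with number \<open>k\<close> on the
  radius to \<open>t i\<close>.
\<close>

definition jets :: "(nat \<times> nat) set" where
  "jets = Sigma A (\<lambda>i. {..<N i})"

definition node :: "nat \<Rightarrow> nat \<times> nat \<Rightarrow> complex" where
  "node s a = t (fst a) * (1 - of_real (step (fst a) s) * of_nat (Suc (snd a)))"

definition divided_difference :: "nat \<Rightarrow> (complex \<Rightarrow> complex) \<Rightarrow> nat \<times> nat \<Rightarrow> complex" where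
  "divided_difference s f a =
     (\<Sum>j\<le>snd a. \<alpha> (snd a) j * f (node s (fst a, j))) / of_real (step (fst a) s) ^ snd a"

text \<open>
  The mass that the combination \<open>x\<close> of divided differences puts on the node \<open>a\<close>.
\<close>

definition weight :: "(nat \<times> nat \<Rightarrow> complex) \<Rightarrow> nat \<Rightarrow> nat \<times> nat \<Rightarrow> complex" where
  "weight x s a = (\<Sum>k<N (fst a). if snd a \<le> k
     then x (fst a, k) * \<alpha> k (snd a) / of_real (step (fst a) s) ^ k else 0)"

text \<open>
  For \<open>f\<close> analytic at \<open>t i\<close> this is the Taylor coefficient of order \<open>k\<close> at \<open>0\<close> of \<open>f (t i * (1 - u))\<close>
  as a function of \<open>u\<close>.
\<close>

definition jet :: "(complex \<Rightarrow> complex) \<Rightarrow> nat \<times> nat \<Rightarrow> complex" where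
  "jet f a = lim (\<lambda>s. divided_difference s f a)"

definition jet_functional :: "(nat \<times> nat \<Rightarrow> complex) \<Rightarrow> (complex \<Rightarrow> complex) \<Rightarrow> complex" where
  "jet_functional x f = (\<Sum>a\<in>jets. x a * jet f a)"

lemma finite_jets: "finite jets"
  using finite_A by (simp add: jets_def)

lemma sum_jets: "(\<Sum>a\<in>jets. f a) = (\<Sum>i\<in>A. \<Sum>k<N i. f (i, k))"
  using sum.Sigma[of A "\<lambda>i. {..<N i}" "\<lambda>i k. f (i, k)"] finite_A
  by (simp add: jets_def case_prod_unfold)

lemma jetsD: "a \<in> jets \<Longrightarrow> fst a \<in> A" "a \<in> jets \<Longrightarrow> snd a < N (fst a)" "a \<in> jets \<Longrightarrow> 0 < N (fst a)"
  by (auto simp: jets_def)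

lemma step_pos: "a \<in> jets \<Longrightarrow> 0 < step (fst a) s"
  using jetsD(3)[of a] \<eta>_pos[of s] by (simp add: step_def)

lemma step_power: "a \<in> jets \<Longrightarrow> step (fst a) s ^ N (fst a) = \<eta> s"
  using jetsD(3)[of a] \<eta>_pos[of s] by (simp add: step_def)

lemma step_le: "a \<in> jets \<Longrightarrow> step (fst a) s \<le> 1"
  using jetsD(3)[of a] \<eta>_le[of s] by (simp add: step_def)

lemma step_lim:
  assumes "a \<in> jets"
  shows "step (fst a) \<longlonglongrightarrow> 0"
  using tendsto_real_root[OF \<eta>_lim, of "N (fst a)"] unfolding step_def by simp

lemma node_lim:
  assumes "a \<in> jets"
  shows "(\<lambda>s. node s a) \<longlonglongrightarrow> t (fst a)"
proof -
  have "(\<lambda>s. t (fst a) * (1 - of_real (step (fst a) s) * of_nat (Suc (snd a)))) \<longlonglongrightarrow> t (fst a) * (1 - of_real 0 * of_nat (Suc (snd a)))"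
    by (intro tendsto_intros step_lim assms)
  then show ?thesis unfolding node_def by simp
qed

lemma eventually_norm_node:
  assumes "a \<in> jets"
  shows "eventually (\<lambda>s. norm (node s a) = 1 - step (fst a) s * real (Suc (snd a))) sequentially"
proof -
  have "(\<lambda>s. step (fst a) s * real (Suc (snd a))) \<longlonglongrightarrow> 0 * real (Suc (snd a))"
    by (intro tendsto_intros step_lim assms)
  from order_tendstoD(2)[OF this, of 1]
  have "eventually (\<lambda>s. step (fst a) s * real (Suc (snd a)) < 1) sequentially" by simp
  then show ?thesis
  proof eventually_elim
    case (elim s)
    have "node s a = t (fst a) * of_real (1 - step (fst a) s * real (Suc (snd a)))"
      unfolding node_def by (simp only: of_real_diff of_real_mult of_real_1 of_real_of_nat_eq)
    then have "norm (node s a) = \<bar>1 - step (fst a) s * real (Suc (snd a))\<bar>"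
      by (simp only: norm_mult norm_of_real unimodular[OF jetsD(1)[OF assms]] mult_1)
    with elim show ?case by simp
  qed
qed

lemma eventually_node_depth:
  assumes "a \<in> jets"
  shows "eventually (\<lambda>s. norm (node s a) \<le> 1 - step (fst a) s) sequentially"
  using eventually_norm_node[OF assms]
proof eventually_elim
  case (elim s)
  have "step (fst a) s * 1 \<le> step (fst a) s * real (Suc (snd a))"
    using step_pos[OF assms, of s] by (intro mult_left_mono) auto
  with elim show ?case by simp
qed

lemma eventually_node_in_ball:
  assumes "a \<in> jets"
  shows "eventually (\<lambda>s. node s a \<in> ball 0 1) sequentially"
  using eventually_node_depth[OF assms] step_pos[OF assms]
  by (auto elim!: eventually_mono) (smt (verit))

lemma sum_weight:
  "(\<Sum>a\<in>jets. weight x s a * f (node s a)) = (\<Sum>a\<in>jets. x a * divided_difference s f a)"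
proof -
  have "(\<Sum>j<N i. weight x s (i, j) * f (node s (i, j))) = (\<Sum>k<N i. x (i, k) * divided_difference s f (i, k))" for i
  proof -
    have "(\<Sum>j<N i. weight x s (i, j) * f (node s (i, j)))
        = (\<Sum>j<N i. \<Sum>k<N i. if j \<le> k then x (i, k) * \<alpha> k j / of_real (step i s) ^ k * f (node s (i, j)) else 0)"
      unfolding weight_def sum_distrib_right by (intro sum.cong refl) auto
    also have "\<dots> = (\<Sum>k<N i. \<Sum>j<N i. if j \<le> k then x (i, k) * \<alpha> k j / of_real (step i s) ^ k * f (node s (i, j)) else 0)"
      by (rule sum.swap)
    also have "\<dots> = (\<Sum>k<N i. x (i, k) * divided_difference s f (i, k))"
    proof (intro sum.cong refl)
      fix k assume "k \<in> {..<N i}"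
      then have "{..<N i} \<inter> {j. j \<le> k} = {..k}" by auto
      then show "(\<Sum>j<N i. if j \<le> k then x (i, k) * \<alpha> k j / of_real (step i s) ^ k * f (node s (i, j)) else 0)
          = x (i, k) * divided_difference s f (i, k)"
        by (simp add: sum.If_cases divided_difference_def sum_distrib_left sum_divide_distrib mult_ac)
    qed
    finally show ?thesis .
  qed
  then show ?thesis unfolding sum_jets by simp
qed

lemma divided_difference_tendsto_taylor:
  assumes a: "a \<in> jets"
    and F: "eventually (\<lambda>s. norm (f (t (fst a) * (1 - s)) - (\<Sum>q\<le>snd a. c q * s ^ q)) \<le> C * norm s ^ Suc (snd a)) (nhds 0)"
  shows "(\<lambda>s. divided_difference s f a) \<longlonglongrightarrow> c (snd a)"
  using divided_difference_tendsto[OF \<alpha> F step_lim[OF a] step_pos[OF a]]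
  unfolding divided_difference_def node_def by simp

lemma divided_difference_tendsto_jet:
  assumes a: "a \<in> jets" and f: "f analytic_on {t (fst a)}"
  shows "(\<lambda>s. divided_difference s f a) \<longlonglongrightarrow> jet f a"
proof -
  have "(f \<circ> (\<lambda>s. t (fst a) * (1 - s))) analytic_on {0}"
    by (rule analytic_on_compose) (auto intro!: analytic_intros f)
  then obtain c C where "eventually (\<lambda>s. norm (f (t (fst a) * (1 - s)) - (\<Sum>q\<le>snd a. c q * s ^ q)) \<le> C * norm s ^ Suc (snd a)) (nhds 0)"
    using analytic_taylor_bound[of _ "snd a"] unfolding o_def by blast
  from divided_difference_tendsto_taylor[OF a this] show ?thesis
    unfolding jet_def by (simp add: convergentI flip: convergent_LIMSEQ_iff)
qed

lemma jet_resolvent: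
  assumes a: "a \<in> jets" and v: "v \<in> ball 0 1"
  shows "jet (\<lambda>z. 1 / (1 - z * v)) a = (- (t (fst a) * v)) ^ snd a / (1 - t (fst a) * v) ^ Suc (snd a)"
proof -
  have "norm (t (fst a) * v) < 1" using unimodular[OF jetsD(1)[OF a]] v by (simp add: norm_mult)
  then have nz: "1 - t (fst a) * v \<noteq> 0" by auto
  have eq: "1 - t (fst a) * (1 - s) * v = (1 - t (fst a) * v) + t (fst a) * v * s" for s
    by (simp add: algebra_simps)
  obtain C where C: "eventually (\<lambda>s. norm (1 / (1 - t (fst a) * (1 - s) * v) -
      (\<Sum>q\<le>snd a. (- (t (fst a) * v)) ^ q / (1 - t (fst a) * v) ^ Suc q * s ^ q)) \<le> C * norm s ^ Suc (snd a)) (nhds 0)"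
    using geometric_taylor_bound[OF nz, of "t (fst a) * v" "snd a"] unfolding eq by blast
  show ?thesis
    unfolding jet_def by (rule limI) (rule divided_difference_tendsto_taylor[OF a, of "\<lambda>z. 1 / (1 - z * v)", OF C])
qed

lemma sum_weight_tendsto:
  assumes "\<And>i. i \<in> A \<Longrightarrow> f analytic_on {t i}"
  shows "(\<lambda>s. \<Sum>a\<in>jets. weight x s a * f (node s a)) \<longlonglongrightarrow> jet_functional x f"
  unfolding sum_weight jet_functional_def
  by (intro tendsto_sum tendsto_mult tendsto_const divided_difference_tendsto_jet assms jetsD)

text \<open>
  The divided difference of order \<open>k\<close> has weights of size \<open>step^(-k)\<close>, where \<open>k < N i\<close>; since
  \<open>step^(N i) = \<eta>\<close>, these are at most of size \<open>step / \<eta>\<close>.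
\<close>

lemma weight_bound:
  shows "\<exists>L\<ge>0. \<forall>s. \<forall>a\<in>jets. norm (weight x s a) * \<eta> s \<le> L * step (fst a) s"
proof -
  define L0 where "L0 = (\<lambda>a. \<Sum>k<N (fst a). norm (x (fst a, k) * \<alpha> k (snd a)))"
  define L where "L = (\<Sum>a\<in>jets. L0 a)"
  have L0: "L0 a \<ge> 0" for a by (simp add: L0_def sum_nonneg)
  have "norm (weight x s a) * \<eta> s \<le> L * step (fst a) s" if a: "a \<in> jets" for s a
  proof -
    have "norm (weight x s a) * \<eta> s \<le> (\<Sum>k<N (fst a). norm (x (fst a, k) * \<alpha> k (snd a)) / step (fst a) s ^ k) * \<eta> s"
      unfolding weight_def using \<eta>_pos[of s] step_pos[OF a, of s]
      by (intro mult_right_mono order_trans[OF norm_sum] sum_mono) (auto simp: norm_divide norm_power norm_mult)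
    also have "\<dots> \<le> (\<Sum>k<N (fst a). norm (x (fst a, k) * \<alpha> k (snd a)) * step (fst a) s)"
      unfolding sum_distrib_right
    proof (rule sum_mono)
      fix k assume "k \<in> {..<N (fst a)}"
      then have k: "k + (N (fst a) - k) = N (fst a)" "Suc 0 \<le> N (fst a) - k" by auto
      have "\<eta> s / step (fst a) s ^ k = step (fst a) s ^ (N (fst a) - k)"
        using step_pos[OF a, of s] step_power[OF a, of s] k(1)
        by (metis nonzero_mult_div_cancel_left power_add power_not_zero less_irrefl)
      also have "\<dots> \<le> step (fst a) s"
        using power_decreasing[OF k(2), of "step (fst a) s"] step_pos[OF a, of s] step_le[OF a, of s] by simp
      finally have "norm (x (fst a, k) * \<alpha> k (snd a)) * (\<eta> s / step (fst a) s ^ k) \<le> norm (x (fst a, k) * \<alpha> k (snd a)) * step (fst a) s"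
        by (intro mult_left_mono) auto
      then show "norm (x (fst a, k) * \<alpha> k (snd a)) / step (fst a) s ^ k * \<eta> s \<le> norm (x (fst a, k) * \<alpha> k (snd a)) * step (fst a) s"
        by simp
    qed
    also have "\<dots> = L0 a * step (fst a) s" by (simp add: L0_def sum_distrib_right)
    also have "\<dots> \<le> L * step (fst a) s"
      unfolding L_def using a L0 step_pos[OF a, of s] finite_jets
      by (intro mult_right_mono member_le_sum) auto
    finally show ?thesis .
  qed
  moreover have "L \<ge> 0" by (simp add: L_def L0 sum_nonneg)
  ultimately show ?thesis by blast
qed

lemma \<eta>_le_step:
  assumes "a \<in> jets"
  shows "\<eta> s \<le> step (fst a) s"
  using power_decreasing[of 1 "N (fst a)" "step (fst a) s"] jetsD(3)[OF assms] step_le[OF assms, of s]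
    step_pos[OF assms, of s] step_power[OF assms, of s] by simp

text \<open>
  The factor \<open>step / \<eta>^2\<close> is \<open>step^(1 - 2 N i)\<close>, hence at most \<open>step^(- m)\<close>, while the distance of a node from
  \<open>t i\<close> is a fixed multiple of \<open>step\<close>.
\<close>

lemma asymptotics_at_nodes:
  assumes a: "a \<in> jets" and m: "2 * N (fst a) \<le> Suc m"
    and f: "f \<in> o[at (t (fst a)) within stolz_region (t (fst a)) 2](\<lambda>z. (z - t (fst a)) ^ m)"
  shows "(\<lambda>s. norm (f (node s a)) * step (fst a) s / (\<eta> s)\<^sup>2) \<longlonglongrightarrow> 0"
proof -
  define T where "T = t (fst a)"
  have dist: "norm (node s a - T) = step (fst a) s * real (Suc (snd a))" for s
  proof -
    have "node s a - T = - (T * of_real (step (fst a) s * real (Suc (snd a))))"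
      by (simp add: node_def T_def algebra_simps)
    then have "norm (node s a - T) = \<bar>step (fst a) s * real (Suc (snd a))\<bar>"
      using unimodular[OF jetsD(1)[OF a]] by (simp only: norm_minus_cancel norm_mult norm_of_real T_def mult_1)
    also have "\<dots> = step (fst a) s * real (Suc (snd a))"
      using step_pos[OF a, of s] by (intro abs_of_nonneg mult_nonneg_nonneg) auto
    finally show ?thesis .
  qed
  have "filterlim (\<lambda>s. node s a) (at T within stolz_region T 2) sequentially"
    unfolding filterlim_at
  proof
    show "eventually (\<lambda>s. node s a \<in> stolz_region T 2 \<and> node s a \<noteq> T) sequentially"
      using eventually_norm_node[OF a] eventually_node_in_ball[OF a]
    proof eventually_elim
      case (elim s)
      have pos: "0 < step (fst a) s * real (Suc (snd a))" using step_pos[OF a, of s] by simp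
      then have "node s a \<noteq> T" using dist[of s] by auto
      moreover have "norm (node s a - T) < 2 * (1 - norm (node s a))"

      proof -
        have "u < 2 * (1 - (1 - u))" if "0 < u" for u :: real using that by simp
        from this[OF pos] show ?thesis unfolding elim(1) dist .
      qed
      ultimately show ?case using elim(2) by (simp add: stolz_region_def)
    qed
    show "(\<lambda>s. node s a) \<longlonglongrightarrow> T" unfolding T_def by (rule node_lim[OF a])
  qed
  then have "(\<lambda>s. f (node s a) / (node s a - T) ^ m) \<longlonglongrightarrow> 0"
    using filterlim_compose[OF smalloD_tendsto[OF f]] unfolding T_def by blast
  then have "(\<lambda>s. real (Suc (snd a)) ^ m * norm (f (node s a) / (node s a - T) ^ m)) \<longlonglongrightarrow> real (Suc (snd a)) ^ m * norm (0 :: complex)"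
    by (intro tendsto_mult tendsto_const tendsto_norm)
  then have lim: "(\<lambda>s. real (Suc (snd a)) ^ m * norm (f (node s a) / (node s a - T) ^ m)) \<longlonglongrightarrow> 0" by simp
  show ?thesis
  proof (rule Lim_null_comparison[OF always_eventually lim], rule allI)
    fix s
    define \<sigma> where "\<sigma> = step (fst a) s"
    have \<sigma>: "0 < \<sigma>" "\<sigma> \<le> 1" using step_pos[OF a] step_le[OF a] by (simp_all add: \<sigma>_def)
    have "\<sigma> * \<sigma> ^ m \<le> \<sigma> ^ (2 * N (fst a))"
      using power_decreasing[OF m, of \<sigma>] \<sigma> by simp
    also have "\<dots> = (\<eta> s)\<^sup>2" using step_power[OF a, of s] by (simp add: \<sigma>_def power_mult power_mult_distrib mult.commute[of 2])
    finally have "\<sigma> / (\<eta> s)\<^sup>2 \<le> 1 / \<sigma> ^ m" using \<sigma> \<eta>_pos[of s] by (simp add: field_simps)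
    then have "norm (f (node s a)) * (\<sigma> / (\<eta> s)\<^sup>2) \<le> norm (f (node s a)) * (1 / \<sigma> ^ m)"
      by (intro mult_left_mono) auto
    also have "\<dots> = real (Suc (snd a)) ^ m * norm (f (node s a) / (node s a - T) ^ m)"
      unfolding norm_divide norm_power dist \<sigma>_def[symmetric] power_mult_distrib by (simp del: of_nat_Suc)
    finally show "norm (norm (f (node s a)) * step (fst a) s / (\<eta> s)\<^sup>2) \<le> real (Suc (snd a)) ^ m * norm (f (node s a) / (node s a - T) ^ m)"
      using \<sigma> \<eta>_pos[of s] by (simp add: \<sigma>_def)
  qed
qed

lemma step_ratio_ge_1:
  assumes "a \<in> jets"
  shows "1 \<le> step (fst a) s / (\<eta> s)\<^sup>2"
proof -
  have "(\<eta> s)\<^sup>2 \<le> \<eta> s" using \<eta>_le[of s] \<eta>_pos[of s] by (simp add: power2_eq_square mult_left_le)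
  then show ?thesis using \<eta>_le_step[OF assms, of s] \<eta>_pos[of s] by (simp add: field_simps)
qed

text \<open>
  The kernels of \<open>\<phi>\<close> and of \<open>B\<close> differ by
  \<open>- (\<delta> cnj B + \<phi> cnj \<delta>) / (1 - z cnj w)\<close> with \<open>\<delta> = \<phi> - B\<close>.  Nodes \<open>a\<close> and \<open>b\<close> have weights of size
  \<open>step / \<eta>\<close> and the denominator is at least as large as either step.  Cancelling the step of \<open>b\<close> in the term with
  \<open>\<delta>\<close> at \<open>a\<close>, and conversely, leaves \<open>\<delta> step / \<eta>^2\<close>, which tends to \<open>0\<close> by assumption.  What remains is the
  form of the kernel of \<open>B\<close>, whose limit vanishes since \<open>x\<close> is a null vector.
\<close>

lemma boundary_gram_tendsto_0:
  assumes B: "\<And>z w. z \<in> ball 0 1 \<Longrightarrow> w \<in> ball 0 1 \<Longrightarrow>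
        1 - B z * cnj (B w) = (1 - z * cnj w) * (\<Sum>p<l. e p z * cnj (e p w))"
    and e: "\<And>p i. i \<in> A \<Longrightarrow> e p analytic_on {t i}"
    and \<phi>: "\<And>a. a \<in> jets \<Longrightarrow> (\<lambda>s. norm (\<phi> s a - B (node s a)) * step (fst a) s / (\<eta> s)\<^sup>2) \<longlonglongrightarrow> 0"
    and x: "\<And>p. p < l \<Longrightarrow> jet_functional x (e p) = 0"
  shows "(\<lambda>s. \<Sum>a\<in>jets. \<Sum>b\<in>jets. weight x s a * cnj (weight y s b) *
     ((1 - \<phi> s a * cnj (\<phi> s b)) / (1 - node s a * cnj (node s b)))) \<longlonglongrightarrow> 0"
proof -
  obtain L where L: "L \<ge> 0" "\<And>s a. a \<in> jets \<Longrightarrow> norm (weight x s a) * \<eta> s \<le> L * step (fst a) s"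
    using weight_bound[of x] by blast
  obtain L' where L': "L' \<ge> 0" "\<And>s a. a \<in> jets \<Longrightarrow> norm (weight y s a) * \<eta> s \<le> L' * step (fst a) s"
    using weight_bound[of y] by blast
  have B1: "norm (B z) \<le> 1" if "z \<in> ball 0 1" for z
    using contractive_from_kernel[of B z e l, OF B[OF that that] that] .
  define d where "d = (\<lambda>s a. norm (\<phi> s a - B (node s a)) * step (fst a) s / (\<eta> s)\<^sup>2)"
  define R where "R = (\<lambda>s a b. weight x s a * cnj (weight y s b) *
     ((1 - \<phi> s a * cnj (\<phi> s b)) / (1 - node s a * cnj (node s b)) - (\<Sum>p<l. e p (node s a) * cnj (e p (node s b)))))"
  have R0: "(\<lambda>s. R s a b) \<longlonglongrightarrow> 0" if a: "a \<in> jets" and b: "b \<in> jets" for a b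
  proof (rule Lim_null_comparison)
    have "eventually (\<lambda>s. d s a < 1) sequentially"
      using order_tendstoD(2)[OF \<phi>[OF a], of 1] by (simp add: d_def)
    then show "eventually (\<lambda>s. norm (R s a b) \<le> L * L' * (d s a + 2 * d s b)) sequentially"
      using eventually_node_depth[OF a] eventually_node_depth[OF b]
        eventually_node_in_ball[OF a] eventually_node_in_ball[OF b]
    proof eventually_elim
      case (elim s)
      define za zb where "za = node s a" and "zb = node s b"
      define \<sigma>a \<sigma>b where "\<sigma>a = step (fst a) s" and "\<sigma>b = step (fst b) s"
      define \<delta>a \<delta>b where "\<delta>a = \<phi> s a - B za" and "\<delta>b = \<phi> s b - B zb"
      define D where "D = norm (1 - za * cnj zb)"
      have pos: "\<sigma>a > 0" "\<sigma>b > 0" "\<eta> s > 0"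
        using step_pos[OF a] step_pos[OF b] \<eta>_pos by (simp_all add: \<sigma>a_def \<sigma>b_def)
      have z: "norm za \<le> 1 - \<sigma>a" "norm zb \<le> 1 - \<sigma>b"
        using elim by (simp_all add: za_def zb_def \<sigma>a_def \<sigma>b_def)
      have zz: "za \<in> ball 0 1" "zb \<in> ball 0 1" using elim by (simp_all add: za_def zb_def)
      have "1 - norm (za * cnj zb) \<le> D"
        using norm_triangle_ineq2[of 1 "za * cnj zb"] by (simp add: D_def)
      moreover have "norm (za * cnj zb) \<le> norm za * 1"
        unfolding norm_mult using zz by (intro mult_left_mono) auto
      moreover have "norm (za * cnj zb) \<le> 1 * norm zb"
        unfolding norm_mult complex_mod_cnj using zz by (intro mult_right_mono) auto
      ultimately have D: "\<sigma>a \<le> D" "\<sigma>b \<le> D" using z by auto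
      have D0: "1 - za * cnj zb \<noteq> 0" using D pos by (auto simp: D_def)
      have da: "norm \<delta>a * \<sigma>a = d s a * (\<eta> s)\<^sup>2" "norm \<delta>b * \<sigma>b = d s b * (\<eta> s)\<^sup>2"
        using pos by (simp_all add: d_def \<delta>a_def \<delta>b_def \<sigma>a_def \<sigma>b_def za_def zb_def)
      have dpos: "d s a \<ge> 0" "d s b \<ge> 0" using pos by (auto simp: d_def \<sigma>a_def[symmetric] \<sigma>b_def[symmetric])
      \<comment> \<open>\<open>\<eta> \<le> step\<close> and \<open>\<eta> \<le> 1\<close> give \<open>norm \<delta>a \<le> d s a\<close>, and \<open>d s a < 1\<close> for large \<open>s\<close>.\<close>
      have "norm \<delta>a \<le> 1"
      proof -
        have "norm \<delta>a * \<eta> s \<le> norm \<delta>a * \<sigma>a"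
          using \<eta>_le_step[OF a] by (intro mult_left_mono) (auto simp: \<sigma>a_def)
        also have "\<dots> \<le> 1 * (\<eta> s)\<^sup>2" unfolding da using elim(1) by (intro mult_right_mono) auto
        also have "\<dots> = \<eta> s * \<eta> s" by (simp add: power2_eq_square)
        also have "\<dots> \<le> 1 * \<eta> s" using \<eta>_le[of s] pos by (intro mult_right_mono) auto
        finally show ?thesis using pos by simp
      qed
      then have \<phi>a: "norm (\<phi> s a) \<le> 2"
        using norm_triangle_ineq[of \<delta>a "B za"] B1[OF zz(1)] by (simp add: \<delta>a_def)
      have "R s a b = weight x s a * cnj (weight y s b) * (- (\<delta>a * cnj (B zb) + \<phi> s a * cnj \<delta>b) / (1 - za * cnj zb))"
      proof -
        have "(\<Sum>p<l. e p za * cnj (e p zb)) = (1 - B za * cnj (B zb)) / (1 - za * cnj zb)"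
          using B[OF zz] D0 by (simp add: field_simps)
        moreover have "(1 - \<phi> s a * cnj (\<phi> s b)) - (1 - B za * cnj (B zb)) = - (\<delta>a * cnj (B zb) + \<phi> s a * cnj \<delta>b)"
          by (simp add: \<delta>a_def \<delta>b_def algebra_simps)
        ultimately show ?thesis
          unfolding R_def za_def[symmetric] zb_def[symmetric] by (simp only: diff_divide_distrib[symmetric])
      qed
      then have "norm (R s a b) = norm (weight x s a) * norm (weight y s b) * norm (\<delta>a * cnj (B zb) + \<phi> s a * cnj \<delta>b) / D"
        by (simp only: norm_mult norm_divide norm_minus_cancel complex_mod_cnj D_def times_divide_eq_right)
      also have "norm (\<delta>a * cnj (B zb) + \<phi> s a * cnj \<delta>b) \<le> norm \<delta>a + 2 * norm \<delta>b"
      proof -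
        have "norm (\<delta>a * cnj (B zb)) \<le> norm \<delta>a * 1"
          unfolding norm_mult using B1[OF zz(2)] by (intro mult_left_mono) auto
        moreover have "norm (\<phi> s a * cnj \<delta>b) \<le> 2 * norm \<delta>b"
          unfolding norm_mult using \<phi>a by (intro mult_mono) auto
        ultimately show ?thesis using norm_triangle_ineq[of "\<delta>a * cnj (B zb)" "\<phi> s a * cnj \<delta>b"] by linarith
      qed
      also have "norm (weight x s a) * norm (weight y s b) * (norm \<delta>a + 2 * norm \<delta>b) / D
          \<le> (L * \<sigma>a / \<eta> s) * (L' * \<sigma>b / \<eta> s) * (norm \<delta>a + 2 * norm \<delta>b) / D"
        using L(2)[OF a, of s] L'(2)[OF b, of s] L(1) L'(1) pos
        by (intro divide_right_mono mult_right_mono mult_mono)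
           (auto simp: pos_le_divide_eq \<sigma>a_def[symmetric] \<sigma>b_def[symmetric] D_def)
      also have "\<dots> = L * L' / (\<eta> s)\<^sup>2 * (\<sigma>a * norm \<delta>a * (\<sigma>b / D) + 2 * (\<sigma>b * norm \<delta>b) * (\<sigma>a / D))"
        using pos D by (simp add: field_simps power2_eq_square)
      also have "\<dots> \<le> L * L' / (\<eta> s)\<^sup>2 * (\<sigma>a * norm \<delta>a * 1 + 2 * (\<sigma>b * norm \<delta>b) * 1)"
        using pos D L(1) L'(1) by (intro mult_left_mono add_mono) auto
      also have "\<dots> = L * L' * (d s a + 2 * d s b)"
      proof -
        have "\<sigma>a * norm \<delta>a = d s a * (\<eta> s)\<^sup>2" "\<sigma>b * norm \<delta>b = d s b * (\<eta> s)\<^sup>2"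
          using da by (simp_all only: mult.commute)
        moreover have "K / E * (u * E * 1 + 2 * (v * E) * 1) = K * (u + 2 * v)" if "E \<noteq> 0" for K E u v :: real
          using that by (simp add: field_simps)
        ultimately show ?thesis using pos by simp
      qed
      finally show ?case by (simp add: divide_right_mono mult_left_mono D_def)
    qed
    have "(\<lambda>s. L * L' * (d s a + 2 * d s b)) \<longlonglongrightarrow> L * L' * (0 + 2 * 0)"
      unfolding d_def by (intro tendsto_intros \<phi> a b)
    then show "(\<lambda>s. L * L' * (d s a + 2 * d s b)) \<longlonglongrightarrow> 0" by simp
  qed
  have "(\<Sum>a\<in>jets. \<Sum>b\<in>jets. weight x s a * cnj (weight y s b) *
     ((1 - \<phi> s a * cnj (\<phi> s b)) / (1 - node s a * cnj (node s b))))
     = (\<Sum>a\<in>jets. \<Sum>b\<in>jets. R s a b) +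
       (\<Sum>p<l. (\<Sum>a\<in>jets. weight x s a * e p (node s a)) * cnj (\<Sum>b\<in>jets. weight y s b * e p (node s b)))" for s
  proof -
    have "(\<Sum>p<l. (\<Sum>a\<in>jets. weight x s a * e p (node s a)) * cnj (\<Sum>b\<in>jets. weight y s b * e p (node s b)))
       = (\<Sum>p<l. \<Sum>a\<in>jets. \<Sum>b\<in>jets. weight x s a * e p (node s a) * cnj (weight y s b * e p (node s b)))"
      by (simp only: cnj_sum sum_product)
    also have "\<dots> = (\<Sum>a\<in>jets. \<Sum>p<l. \<Sum>b\<in>jets. weight x s a * e p (node s a) * cnj (weight y s b * e p (node s b)))"
      by (rule sum.swap)
    also have "\<dots> = (\<Sum>a\<in>jets. \<Sum>b\<in>jets. \<Sum>p<l. weight x s a * e p (node s a) * cnj (weight y s b * e p (node s b)))"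
      by (intro sum.cong refl sum.swap)
    also have "\<dots> = (\<Sum>a\<in>jets. \<Sum>b\<in>jets. weight x s a * cnj (weight y s b) * (\<Sum>p<l. e p (node s a) * cnj (e p (node s b))))"
      unfolding sum_distrib_left by (intro sum.cong refl) (simp only: complex_cnj_mult mult_ac)
    finally show ?thesis unfolding R_def by (simp add: right_diff_distrib sum_subtractf)
  qed
  moreover have "(\<lambda>s. (\<Sum>a\<in>jets. \<Sum>b\<in>jets. R s a b) +
       (\<Sum>p<l. (\<Sum>a\<in>jets. weight x s a * e p (node s a)) * cnj (\<Sum>b\<in>jets. weight y s b * e p (node s b))))
     \<longlonglongrightarrow> 0 + (\<Sum>p<l. jet_functional x (e p) * cnj (jet_functional y (e p)))"
    by (intro tendsto_add tendsto_null_sum tendsto_sum tendsto_mult tendsto_cnj sum_weight_tendsto R0 e)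
  moreover have "(\<Sum>p<l. jet_functional x (e p) * cnj (jet_functional y (e p))) = 0"
    using x by simp
  ultimately show ?thesis by simp
qed

lemma boundary_point_tendsto:
  assumes B: "\<And>i. i \<in> A \<Longrightarrow> B analytic_on {t i}" and w: "w \<in> ball 0 1"
    and \<phi>: "\<And>a. a \<in> jets \<Longrightarrow> (\<lambda>s. norm (\<phi> s a - B (node s a)) * step (fst a) s / (\<eta> s)\<^sup>2) \<longlonglongrightarrow> 0"
  shows "(\<lambda>s. \<Sum>a\<in>jets. weight x s a * ((c - \<phi> s a * d) / (1 - node s a * cnj w)))
     \<longlonglongrightarrow> c * jet_functional x (\<lambda>z. 1 / (1 - z * cnj w)) - d * jet_functional x (\<lambda>z. B z / (1 - z * cnj w))"
proof -
  obtain L where L: "L \<ge> 0" "\<And>s a. a \<in> jets \<Longrightarrow> norm (weight x s a) * \<eta> s \<le> L * step (fst a) s"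
    using weight_bound[of x] by blast
  have nz: "1 - t i * cnj w \<noteq> 0" if "i \<in> A" for i
    using unit_disk_denominator_nonzero(1)[of w "t i"] unimodular[OF that] w by (simp add: mult.commute)
  have an1: "(\<lambda>z. 1 / (1 - z * cnj w)) analytic_on {t i}" if "i \<in> A" for i
    by (intro analytic_intros) (use nz that in auto)
  have an2: "(\<lambda>z. B z / (1 - z * cnj w)) analytic_on {t i}" if "i \<in> A" for i
    by (intro analytic_intros B) (use nz that in auto)
  have R0: "(\<lambda>s. weight x s a * ((\<phi> s a - B (node s a)) / (1 - node s a * cnj w))) \<longlonglongrightarrow> 0"
    if a: "a \<in> jets" for a
  proof (rule Lim_null_comparison)
    show "eventually (\<lambda>s. norm (weight x s a * ((\<phi> s a - B (node s a)) / (1 - node s a * cnj w)))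
       \<le> L / (1 - norm w) * (norm (\<phi> s a - B (node s a)) * step (fst a) s / (\<eta> s)\<^sup>2)) sequentially"
      using eventually_node_in_ball[OF a]
    proof eventually_elim
      case (elim s)
      define \<delta> where "\<delta> = norm (\<phi> s a - B (node s a))"
      have pos: "\<eta> s > 0" "step (fst a) s > 0" "1 - norm w > 0" using \<eta>_pos step_pos[OF a] w by auto
      have "1 - norm (node s a * cnj w) \<le> norm (1 - node s a * cnj w)"
        using norm_triangle_ineq2[of 1 "node s a * cnj w"] by simp
      moreover have "norm (node s a * cnj w) \<le> 1 * norm w"
        unfolding norm_mult complex_mod_cnj using elim by (intro mult_right_mono) auto
      ultimately have D: "1 - norm w \<le> norm (1 - node s a * cnj w)" by linarith
      have "norm (weight x s a * ((\<phi> s a - B (node s a)) / (1 - node s a * cnj w)))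
          = norm (weight x s a) * (\<delta> / norm (1 - node s a * cnj w))"
        by (simp add: norm_mult norm_divide \<delta>_def)
      also have "\<dots> \<le> (L * step (fst a) s / \<eta> s) * (\<delta> / (1 - norm w))"
        using L(2)[OF a, of s] L(1) pos D
        by (intro mult_mono divide_left_mono mult_pos_pos) (auto simp: pos_le_divide_eq \<delta>_def)
      also have "\<dots> = L / (1 - norm w) * (\<delta> * step (fst a) s) / \<eta> s" by (simp add: mult_ac)
      also have "\<dots> \<le> L / (1 - norm w) * (\<delta> * step (fst a) s) / (\<eta> s)\<^sup>2"
        using pos L(1) \<eta>_le[of s]
        by (intro divide_left_mono mult_nonneg_nonneg) (auto simp: \<delta>_def power2_eq_square mult_left_le)
      finally show ?case by (simp add: \<delta>_def)
    qed
    show "(\<lambda>s. L / (1 - norm w) * (norm (\<phi> s a - B (node s a)) * step (fst a) s / (\<eta> s)\<^sup>2)) \<longlonglongrightarrow> 0"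
      by (rule tendsto_mult_right_zero[OF \<phi>[OF a]])
  qed
  have "(\<Sum>a\<in>jets. weight x s a * ((c - \<phi> s a * d) / (1 - node s a * cnj w)))
     = c * (\<Sum>a\<in>jets. weight x s a * (1 / (1 - node s a * cnj w)))
       - d * (\<Sum>a\<in>jets. weight x s a * (B (node s a) / (1 - node s a * cnj w)))
       - d * (\<Sum>a\<in>jets. weight x s a * ((\<phi> s a - B (node s a)) / (1 - node s a * cnj w)))" for s
    unfolding sum_distrib_left sum_subtractf[symmetric]
    by (intro sum.cong refl) (simp add: algebra_simps diff_divide_distrib)
  moreover have "(\<lambda>s. c * (\<Sum>a\<in>jets. weight x s a * (1 / (1 - node s a * cnj w)))
       - d * (\<Sum>a\<in>jets. weight x s a * (B (node s a) / (1 - node s a * cnj w)))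
       - d * (\<Sum>a\<in>jets. weight x s a * ((\<phi> s a - B (node s a)) / (1 - node s a * cnj w))))
    \<longlonglongrightarrow> c * jet_functional x (\<lambda>z. 1 / (1 - z * cnj w)) - d * jet_functional x (\<lambda>z. B z / (1 - z * cnj w)) - d * 0"
    by (intro tendsto_diff tendsto_mult tendsto_const tendsto_null_sum R0
        sum_weight_tendsto[of "\<lambda>z. 1 / (1 - z * cnj w)"] sum_weight_tendsto[of "\<lambda>z. B z / (1 - z * cnj w)"] an1 an2)
  ultimately show ?thesis by simp
qed


text \<open>
  A functional that annihilates the functions \<open>e p\<close> annihilates the kernel of \<open>B\<close> at every point \<open>w\<close>.
\<close>

lemma jet_resolvent_identity:
  assumes B: "\<And>z w. z \<in> ball 0 1 \<Longrightarrow> w \<in> ball 0 1 \<Longrightarrow>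
        1 - B z * cnj (B w) = (1 - z * cnj w) * (\<Sum>p<l. e p z * cnj (e p w))"
    and an: "\<And>i. i \<in> A \<Longrightarrow> B analytic_on {t i}" "\<And>p i. i \<in> A \<Longrightarrow> e p analytic_on {t i}"
    and x: "\<And>p. p < l \<Longrightarrow> jet_functional x (e p) = 0" and w: "w \<in> ball 0 1"
  shows "jet_functional x (\<lambda>z. 1 / (1 - z * cnj w)) = cnj (B w) * jet_functional x (\<lambda>z. B z / (1 - z * cnj w))"
proof -
  have "eventually (\<lambda>s. \<forall>a\<in>jets. node s a \<in> ball 0 1) sequentially"
    using finite_jets eventually_node_in_ball by (intro eventually_ball_finite) auto
  then have ev: "eventually (\<lambda>s. (\<Sum>p<l. (\<Sum>a\<in>jets. weight x s a * e p (node s a)) * cnj (e p w))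
      = (\<Sum>a\<in>jets. weight x s a * ((1 - B (node s a) * cnj (B w)) / (1 - node s a * cnj w)))) sequentially"
  proof eventually_elim
    case (elim s)
    have "(\<Sum>p<l. (\<Sum>a\<in>jets. weight x s a * e p (node s a)) * cnj (e p w))
        = (\<Sum>p<l. \<Sum>a\<in>jets. weight x s a * (e p (node s a) * cnj (e p w)))"
      by (simp only: sum_distrib_right mult.assoc)
    also have "\<dots> = (\<Sum>a\<in>jets. weight x s a * (\<Sum>p<l. e p (node s a) * cnj (e p w)))"
      unfolding sum_distrib_left by (rule sum.swap)
    also have "\<dots> = (\<Sum>a\<in>jets. weight x s a * ((1 - B (node s a) * cnj (B w)) / (1 - node s a * cnj w)))"
    proof (intro sum.cong refl)
      fix a assume "a \<in> jets"
      then have z: "node s a \<in> ball 0 1" using elim by blast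
      then have "1 - node s a * cnj w \<noteq> 0"
        using unit_disk_denominator_nonzero(2)[of "node s a" w] w by simp
      then show "weight x s a * (\<Sum>p<l. e p (node s a) * cnj (e p w))
          = weight x s a * ((1 - B (node s a) * cnj (B w)) / (1 - node s a * cnj w))"
        unfolding B[OF z w] by simp
    qed
    finally show ?case .
  qed
  have "(\<lambda>s. \<Sum>p<l. (\<Sum>a\<in>jets. weight x s a * e p (node s a)) * cnj (e p w)) \<longlonglongrightarrow> (\<Sum>p<l. jet_functional x (e p) * cnj (e p w))"
    by (intro tendsto_sum tendsto_mult tendsto_const sum_weight_tendsto an)
  from Lim_transform_eventually[OF this ev]
  have lim0: "(\<lambda>s. \<Sum>a\<in>jets. weight x s a * ((1 - B (node s a) * cnj (B w)) / (1 - node s a * cnj w))) \<longlonglongrightarrow> 0"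
    using x by simp
  have "(\<lambda>s. \<Sum>a\<in>jets. weight x s a * ((1 - B (node s a) * cnj (B w)) / (1 - node s a * cnj w)))
     \<longlonglongrightarrow> 1 * jet_functional x (\<lambda>z. 1 / (1 - z * cnj w)) - cnj (B w) * jet_functional x (\<lambda>z. B z / (1 - z * cnj w))"
    by (rule boundary_point_tendsto) (use an w in auto)
  from LIMSEQ_unique[OF this lim0] show ?thesis by simp
qed

text \<open>
  Otherwise every nonzero null functional of the kernel of \<open>B\<close> is detected by a point of \<open>\<Omega>\<close>.  As more than
  \<open>\<kappa> + l\<close> jets are available, this produces \<open>\<kappa> + 1\<close> null functionals \<open>x p\<close> and points \<open>w q\<close> that are dual to
  each other.  The vectors \<open>w p - \<tau> x p\<close> have a Gram matrix that tends to \<open>- 2 \<tau>\<close> times the identity plus the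
  Gram matrix of the points, and for large \<open>\<tau>\<close> this contradicts the bound on the negative squares.
\<close>

lemma exists_annihilating_jet:
  assumes h: "has_negative_squares (caratheodory_kernel h) \<Omega> q" "q \<le> \<kappa>"
    and \<Omega>: "\<Omega> \<subseteq> ball 0 1"
    and b: "\<And>z w. z \<in> ball 0 1 \<Longrightarrow> w \<in> ball 0 1 \<Longrightarrow>
        1 - b z * cnj (b w) = (1 - z * cnj w) * (\<Sum>p<r. e' p z * cnj (e' p w))"
    and B: "\<And>z w. z \<in> ball 0 1 \<Longrightarrow> w \<in> ball 0 1 \<Longrightarrow>
        1 - B z * cnj (B w) = (1 - z * cnj w) * (\<Sum>p<l. e p z * cnj (e p w))"
    and an: "\<And>i. i \<in> A \<Longrightarrow> B analytic_on {t i}" "\<And>p i. i \<in> A \<Longrightarrow> e p analytic_on {t i}"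
    and node: "\<And>a. a \<in> jets \<Longrightarrow> eventually (\<lambda>s. node s a \<in> \<Omega>) sequentially"
    and nz: "\<And>a. a \<in> jets \<Longrightarrow> eventually (\<lambda>s. h (node s a) + 1 \<noteq> 0) sequentially"
    and \<phi>: "\<And>a. a \<in> jets \<Longrightarrow> (\<lambda>s. norm (b (node s a) * (h (node s a) - 1) / (h (node s a) + 1)
        - B (node s a)) * step (fst a) s / (\<eta> s)\<^sup>2) \<longlonglongrightarrow> 0"
    and card: "\<kappa> + l < card jets"
  shows "\<exists>x. (\<exists>a\<in>jets. x a \<noteq> 0) \<and> (\<forall>p<l. jet_functional x (e p) = 0) \<and>
     (\<forall>w\<in>\<Omega>. cnj (h w + 1) * jet_functional x (\<lambda>z. 1 / (1 - z * cnj w))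
        = cnj (b w * (h w - 1)) * jet_functional x (\<lambda>z. B z / (1 - z * cnj w)))"
proof (rule ccontr)
  assume contra: "\<not> ?thesis"
  define pair where "pair = (\<lambda>x w. cnj (h w + 1) * jet_functional x (\<lambda>z. 1 / (1 - z * cnj w))
        - cnj (b w * (h w - 1)) * jet_functional x (\<lambda>z. B z / (1 - z * cnj w)))"
  define X where "X = (\<lambda>x. \<forall>p<l. jet_functional x (e p) = 0)"
  have lin: "jet_functional (\<lambda>i. x i + c * y i) f = jet_functional x f + c * jet_functional y f" for x y c f
    by (simp add: jet_functional_def algebra_simps sum.distrib sum_distrib_left)
  have step: "\<exists>x s. X x \<and> s \<in> \<Omega> \<and> (\<forall>s'\<in>T. pair x s' = 0) \<and> pair x s \<noteq> 0"
    if T: "finite T" "card T < Suc \<kappa>" "T \<subseteq> \<Omega>" for T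
  proof -
    \<comment> \<open>At most \<open>l + \<kappa>\<close> linear equations: \<open>l\<close> for a null functional, one for each point of \<open>T\<close>.\<close>
    define c where "c = (\<lambda>j a. case j of Inl p \<Rightarrow> jet (e p) a
      | Inr w \<Rightarrow> cnj (h w + 1) * jet (\<lambda>z. 1 / (1 - z * cnj w)) a - cnj (b w * (h w - 1)) * jet (\<lambda>z. B z / (1 - z * cnj w)) a)"
    have "card ({..<l} <+> T) < card jets" using T card by (simp add: card_Plus)
    then obtain x where x: "\<exists>a\<in>jets. x a \<noteq> 0" "\<forall>j\<in>{..<l} <+> T. (\<Sum>a\<in>jets. c j a * x a) = 0"
      using homogeneous_system_nontrivial[of "{..<l} <+> T" jets c] T(1) finite_jets by auto
    have "X x"
      unfolding X_def
    proof (intro allI impI)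
      fix p assume "p < l"
      then have "(\<Sum>a\<in>jets. c (Inl p) a * x a) = 0" using x(2) by blast
      then show "jet_functional x (e p) = 0" by (simp add: c_def jet_functional_def mult.commute)
    qed
    moreover have "pair x w = 0" if "w \<in> T" for w
    proof -
      have "(\<Sum>a\<in>jets. c (Inr w) a * x a) = 0" using x(2) that by blast
      moreover have "(\<Sum>a\<in>jets. c (Inr w) a * x a) = pair x w"
        unfolding pair_def jet_functional_def c_def sum_distrib_left sum_subtractf[symmetric]
        by (intro sum.cong refl) (simp add: algebra_simps)
      ultimately show ?thesis by simp
    qed
    moreover have "\<exists>s\<in>\<Omega>. pair x s \<noteq> 0"
      using contra x(1) \<open>X x\<close> unfolding X_def pair_def by auto
    ultimately show ?thesis by blast
  qed
  have pair_lin: "pair (\<lambda>i. x i + c * y i) s = pair x s + c * pair y s" for x y c s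
    unfolding pair_def lin by (simp add: algebra_simps)
  have X_lin: "X (\<lambda>i. x i + c * y i)" if "X x" "X y" for x y c
    using that unfolding X_def lin by simp
  have "\<exists>x w. (\<forall>p<Suc \<kappa>. X (x p) \<and> w p \<in> \<Omega>) \<and>
      (\<forall>p<Suc \<kappa>. \<forall>q<Suc \<kappa>. pair (x p) (w q) = (if p = q then 1 else 0))"
    by (rule dual_family[of pair X "Suc \<kappa>"]) (rule pair_lin, rule X_lin, assumption+, rule step, assumption+, rule order_refl)
  then obtain x w where xw0: "\<forall>p<Suc \<kappa>. X (x p) \<and> w p \<in> \<Omega>"
    and dual0: "\<forall>p<Suc \<kappa>. \<forall>q<Suc \<kappa>. pair (x p) (w q) = (if p = q then 1 else 0)"
    by (elim exE conjE) (rule that)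
  have xw: "\<And>p. p \<le> \<kappa> \<Longrightarrow> X (x p)" "\<And>p. p \<le> \<kappa> \<Longrightarrow> w p \<in> \<Omega>"
    and dual: "\<And>p q. p \<le> \<kappa> \<Longrightarrow> q \<le> \<kappa> \<Longrightarrow> pair (x p) (w q) = (if p = q then 1 else 0)"
    using xw0 dual0 by (simp_all add: less_Suc_eq_le)
  define M where "M = (\<lambda>z w. ((h z + 1) * cnj (h w + 1) - b z * (h z - 1) * cnj (b w * (h w - 1))) / (1 - z * cnj w))"
  \<comment> \<open>A strict bound for the Gram matrix of the points; the summand \<open>1\<close> absorbs the error before the limit.\<close>
  define c where "c = 1 + (\<Sum>p\<le>\<kappa>. \<Sum>q\<le>\<kappa>. norm (M (w p) (w q)))"
  define \<tau> where "\<tau> = c * (real (Suc \<kappa>))\<^sup>2"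
  have c: "c > 0" unfolding c_def by (intro add_pos_nonneg sum_nonneg) auto
  then have \<tau>: "c * (real (Suc \<kappa>))\<^sup>2 < 2 * \<tau>" by (simp add: \<tau>_def)
  define \<phi>' where "\<phi>' = (\<lambda>s a. b (node s a) * (h (node s a) - 1) / (h (node s a) + 1))"
  \<comment> \<open>Left indices are nodes near the circle, right indices the points \<open>w q\<close>.  The division by \<open>h + 1\<close> in \<open>C\<close>
    turns the kernel \<open>M\<close> at the nodes into the kernel of \<open>\<phi>'\<close>.\<close>
  define I where "I = jets <+> {..\<kappa>}"
  define zz where "zz = (\<lambda>s. case_sum (node s) w)"
  define C where "C = (\<lambda>s p. case_sum (\<lambda>a. - of_real \<tau> * weight (x p) s a / (h (node s a) + 1)) (\<lambda>q. if p = q then 1 else 0 :: complex))"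
  define H where "H = (\<lambda>s p q. \<Sum>a\<in>I. \<Sum>d\<in>I. M (zz s a) (zz s d) * C s p a * cnj (C s q d))"
  define G where "G = (\<lambda>s p q. \<Sum>a\<in>jets. \<Sum>d\<in>jets. weight (x p) s a * cnj (weight (x q) s d) *
     ((1 - \<phi>' s a * cnj (\<phi>' s d)) / (1 - node s a * cnj (node s d))))"
  define P where "P = (\<lambda>s p q. \<Sum>a\<in>jets. weight (x p) s a *
     ((cnj (h (w q) + 1) - \<phi>' s a * cnj (b (w q) * (h (w q) - 1))) / (1 - node s a * cnj (w q))))"
  have wb: "w p \<in> ball 0 1" if "p \<le> \<kappa>" for p using xw(2)[OF that] \<Omega> by blast
  have G: "(\<lambda>s. G s p q) \<longlonglongrightarrow> 0" if "p \<le> \<kappa>" "q \<le> \<kappa>" for p q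
    unfolding G_def
  proof (rule boundary_gram_tendsto_0[OF B])
    show "jet_functional (x p) (e r) = 0" if "r < l" for r
      using xw(1)[OF \<open>p \<le> \<kappa>\<close>] that unfolding X_def by blast
  qed (use an \<phi> in \<open>auto simp: \<phi>'_def\<close>)
  have P: "(\<lambda>s. P s p q) \<longlonglongrightarrow> (if p = q then 1 else 0)" if "p \<le> \<kappa>" "q \<le> \<kappa>" for p q
    using boundary_point_tendsto[OF an(1) wb[OF that(2)], of \<phi>' "x p" "cnj (h (w q) + 1)" "cnj (b (w q) * (h (w q) - 1))"] \<phi>
    unfolding P_def dual[OF that, symmetric] pair_def \<phi>'_def by blast
  have ev: "eventually (\<lambda>s. \<forall>a\<in>jets. node s a \<in> \<Omega> \<and> h (node s a) + 1 \<noteq> 0) sequentially"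
    using finite_jets node nz by (intro eventually_ball_finite) (auto intro: eventually_conj)
  have H_eq: "H s p q = of_real (\<tau>\<^sup>2) * G s p q - of_real \<tau> * (P s p q + cnj (P s q p)) + M (w p) (w q)"
    if pq: "p \<le> \<kappa>" "q \<le> \<kappa>" and s: "\<forall>a\<in>jets. node s a \<in> \<Omega> \<and> h (node s a) + 1 \<noteq> 0" for s p q
  proof -
    have b\<phi>: "b (node s a) * (h (node s a) - 1) = \<phi>' s a * (h (node s a) + 1)" if "a \<in> jets" for a
      using s that by (simp add: \<phi>'_def)
    define R where "R = (\<lambda>a d. M (zz s a) (zz s d) * C s p a * cnj (C s q d))"
    have "H s p q = (\<Sum>a\<in>jets. \<Sum>d\<in>jets. R (Inl a) (Inl d)) + (\<Sum>a\<in>jets. \<Sum>d\<le>\<kappa>. R (Inl a) (Inr d))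
       + ((\<Sum>a\<le>\<kappa>. \<Sum>d\<in>jets. R (Inr a) (Inl d)) + (\<Sum>a\<le>\<kappa>. \<Sum>d\<le>\<kappa>. R (Inr a) (Inr d)))"
      unfolding H_def I_def R_def by (simp add: sum.Plus finite_jets sum.distrib)
    also have "(\<Sum>a\<in>jets. \<Sum>d\<in>jets. R (Inl a) (Inl d)) = of_real (\<tau>\<^sup>2) * G s p q"
      unfolding G_def sum_distrib_left
    proof (intro sum.cong refl)
      fix a d assume ad: "a \<in> jets" "d \<in> jets"
      have "u * cnj v - \<phi>' s a * u * cnj (\<phi>' s d * v) = (1 - \<phi>' s a * cnj (\<phi>' s d)) * (u * cnj v)" for u v
        by (simp add: algebra_simps)
      then show "R (Inl a) (Inl d) = of_real (\<tau>\<^sup>2) * (weight (x p) s a * cnj (weight (x q) s d) *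
          ((1 - \<phi>' s a * cnj (\<phi>' s d)) / (1 - node s a * cnj (node s d))))"
        using s ad by (simp add: R_def M_def zz_def C_def b\<phi>[OF ad(1)] b\<phi>[OF ad(2)] power2_eq_square
          del: complex_cnj_add complex_cnj_mult) simp
    qed
    also have "(\<Sum>a\<in>jets. \<Sum>d\<le>\<kappa>. R (Inl a) (Inr d)) = - of_real \<tau> * P s p q"
      unfolding P_def sum_distrib_left
    proof (intro sum.cong refl)
      fix a assume a: "a \<in> jets"
      have "(\<Sum>d\<le>\<kappa>. R (Inl a) (Inr d)) = (\<Sum>d\<le>\<kappa>. if d = q then M (node s a) (w q) * C s p (Inl a) else 0)"
        by (intro sum.cong refl) (auto simp: R_def zz_def C_def)
      also have "\<dots> = M (node s a) (w q) * C s p (Inl a)" using pq by simp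
      also have "\<dots> = - of_real \<tau> * (weight (x p) s a *
          ((cnj (h (w q) + 1) - \<phi>' s a * cnj (b (w q) * (h (w q) - 1))) / (1 - node s a * cnj (w q))))"
      proof -
        have "u * v - \<phi>' s a * u * v' = u * (v - \<phi>' s a * v')" for u v v' by (simp add: algebra_simps)
        then show ?thesis
          using s a by (simp add: M_def C_def b\<phi>[OF a] del: complex_cnj_add complex_cnj_mult)
      qed
      finally show "(\<Sum>d\<le>\<kappa>. R (Inl a) (Inr d)) = - of_real \<tau> * (weight (x p) s a *
          ((cnj (h (w q) + 1) - \<phi>' s a * cnj (b (w q) * (h (w q) - 1))) / (1 - node s a * cnj (w q))))" .
    qed
    also have "(\<Sum>a\<le>\<kappa>. \<Sum>d\<in>jets. R (Inr a) (Inl d)) = - of_real \<tau> * cnj (P s q p)"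
      unfolding P_def cnj_sum sum_distrib_left
    proof (subst sum.swap, intro sum.cong refl)
      fix d assume d: "d \<in> jets"
      have "(\<Sum>a\<le>\<kappa>. R (Inr a) (Inl d)) = (\<Sum>a\<le>\<kappa>. if a = p then M (w p) (node s d) * cnj (C s q (Inl d)) else 0)"
        by (intro sum.cong refl) (auto simp: R_def zz_def C_def)
      also have "\<dots> = M (w p) (node s d) * cnj (C s q (Inl d))" using pq by simp
      also have "M (w p) (node s d) = cnj (M (node s d) (w p))" by (simp add: M_def mult_ac)
      also have "cnj (M (node s d) (w p)) * cnj (C s q (Inl d)) = cnj (M (node s d) (w p) * C s q (Inl d))" by simp
      also have "M (node s d) (w p) * C s q (Inl d) = - of_real \<tau> * (weight (x q) s d *
          ((cnj (h (w p) + 1) - \<phi>' s d * cnj (b (w p) * (h (w p) - 1))) / (1 - node s d * cnj (w p))))"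
      proof -
        have "u * v - \<phi>' s d * u * v' = u * (v - \<phi>' s d * v')" for u v v' by (simp add: algebra_simps)
        then show ?thesis
          using s d by (simp add: M_def C_def b\<phi>[OF d] del: complex_cnj_add complex_cnj_mult)
      qed
      also have "cnj (- of_real \<tau> * Q) = - of_real \<tau> * cnj Q" for Q by simp
      finally show "(\<Sum>a\<le>\<kappa>. R (Inr a) (Inl d)) = - of_real \<tau> * cnj (weight (x q) s d *
          ((cnj (h (w p) + 1) - \<phi>' s d * cnj (b (w p) * (h (w p) - 1))) / (1 - node s d * cnj (w p))))" .
    qed
    also have "(\<Sum>a\<le>\<kappa>. \<Sum>d\<le>\<kappa>. R (Inr a) (Inr d)) = (\<Sum>a\<le>\<kappa>. if a = p then M (w p) (w q) else 0)"
    proof (intro sum.cong refl)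
      fix a
      have "(\<Sum>d\<le>\<kappa>. R (Inr a) (Inr d)) = (\<Sum>d\<le>\<kappa>. if d = q then (if a = p then M (w p) (w q) else 0) else 0)"
        by (intro sum.cong refl) (auto simp: R_def zz_def C_def)
      then show "(\<Sum>d\<le>\<kappa>. R (Inr a) (Inr d)) = (if a = p then M (w p) (w q) else 0)" using pq by simp
    qed
    also have "\<dots> = M (w p) (w q)" using pq by simp
    finally show ?thesis by (simp add: algebra_simps)
  qed
  have H_lim: "(\<lambda>s. H s p q + (if p = q then of_real (2 * \<tau>) else 0)) \<longlonglongrightarrow> M (w p) (w q)"
    if pq: "p \<le> \<kappa>" "q \<le> \<kappa>" for p q
  proof -
    have "(\<lambda>s. of_real (\<tau>\<^sup>2) * G s p q - of_real \<tau> * (P s p q + cnj (P s q p)) + M (w p) (w q) + (if p = q then of_real (2 * \<tau>) else 0))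
        \<longlonglongrightarrow> of_real (\<tau>\<^sup>2) * 0 - of_real \<tau> * ((if p = q then 1 else 0) + cnj (if q = p then 1 else 0)) + M (w p) (w q) + (if p = q then of_real (2 * \<tau>) else 0)"
      using pq by (intro tendsto_intros G P)
    moreover have "of_real (\<tau>\<^sup>2) * 0 - of_real \<tau> * ((if p = q then 1 else 0) + cnj (if q = p then 1 else 0)) + M (w p) (w q) + (if p = q then of_real (2 * \<tau>) else 0) = M (w p) (w q)"
      by auto
    ultimately have "(\<lambda>s. of_real (\<tau>\<^sup>2) * G s p q - of_real \<tau> * (P s p q + cnj (P s q p)) + M (w p) (w q) + (if p = q then of_real (2 * \<tau>) else 0))
        \<longlonglongrightarrow> M (w p) (w q)" by simp
    then show ?thesis
      by (rule Lim_transform_eventually) (use ev in \<open>auto elim!: eventually_mono simp: H_eq[OF pq]\<close>)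
  qed
  have "eventually (\<lambda>s. norm (H s p q + (if p = q then of_real (2 * \<tau>) else 0)) < c) sequentially"
    if pq: "p \<le> \<kappa>" "q \<le> \<kappa>" for p q
  proof -
    have "norm (M (w p) (w q)) \<le> (\<Sum>q\<le>\<kappa>. norm (M (w p) (w q)))"
      using pq by (intro member_le_sum) auto
    also have "\<dots> \<le> (\<Sum>p\<le>\<kappa>. \<Sum>q\<le>\<kappa>. norm (M (w p) (w q)))"
      using pq by (intro member_le_sum sum_nonneg) auto
    also have "\<dots> < c" by (simp add: c_def)
    finally show ?thesis using order_tendstoD(2)[OF tendsto_norm[OF H_lim[OF pq]]] by blast
  qed
  then have "eventually (\<lambda>s. \<forall>p\<in>{..\<kappa>}. \<forall>q\<in>{..\<kappa>}. norm (H s p q + (if p = q then of_real (2 * \<tau>) else 0)) < c) sequentially"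
    by (intro eventually_ball_finite ballI) auto
  with ev have "eventually (\<lambda>s. False) sequentially"
  proof eventually_elim
    case (elim s)
    have "\<exists>p\<le>\<kappa>. \<exists>q\<le>\<kappa>. norm ((\<Sum>a\<in>I. \<Sum>d\<in>I. M (zz s a) (zz s d) * C s p a * cnj (C s q d)) + (if p = q then of_real (2 * \<tau>) else 0)) > c"
      unfolding M_def
    proof (rule cayley_gram_matrix_not_negative[OF h \<Omega> _ _ _ \<tau>])
      show "finite I" by (simp add: I_def finite_jets)
      show "zz s a \<in> \<Omega>" if "a \<in> I" for a
        using that elim(1) xw(2) by (auto simp: I_def zz_def)
    qed (fact b)
    then obtain p q where "p \<le> \<kappa>" "q \<le> \<kappa>" "norm (H s p q + (if p = q then of_real (2 * \<tau>) else 0)) > c"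
      unfolding H_def by blast
    then show ?case using elim(2) by (meson atMost_iff less_asym)
  qed
  then show False by simp
qed

end

text \<open>
  Along the radius to \<open>cnj (t i)\<close> the pole of largest order \<open>Suc K\<close> at this point dominates: after
  multiplication by \<open>\<epsilon>^(Suc K)\<close> all other terms tend to \<open>0\<close>, and the coefficient of that pole survives.
\<close>

lemma jet_functional_of_resolvent_nonzero:
  fixes t :: "nat \<Rightarrow> complex" and x :: "nat \<times> nat \<Rightarrow> complex"
  assumes A: "finite A" and t: "\<And>i. i \<in> A \<Longrightarrow> norm (t i) = 1" and inj: "inj_on t A"
    and nz: "\<exists>a\<in>Sigma A (\<lambda>i. {..<N i}). x a \<noteq> 0" and w: "w \<in> ball 0 1"
  shows "eventually (\<lambda>v. (\<Sum>(i, k)\<in>Sigma A (\<lambda>i. {..<N i}).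
            x (i, k) * ((- (t i * v)) ^ k / (1 - t i * v) ^ Suc k)) \<noteq> 0) (at w)"
proof -
  define S where "S = Sigma A (\<lambda>i. {..<N i})"
  define f where "f = (\<lambda>(i, k) v. x (i, k) * ((- (t i * v)) ^ k / (1 - t i * v) ^ Suc k))"
  define R where "R = (\<lambda>v. \<Sum>a\<in>S. f a v)"
  have S: "finite S" using A by (simp add: S_def)
  have den: "1 - t i * v \<noteq> 0" if "i \<in> A" "v \<in> ball 0 1" for i v
  proof
    assume "1 - t i * v = 0"
    then have "norm (t i * v) = 1" by simp
    then show False using t[OF that(1)] that(2) by (simp add: norm_mult)
  qed
  have hol: "R holomorphic_on ball 0 1"
    unfolding R_def f_def case_prod_unfold
    by (intro holomorphic_intros) (use den in \<open>auto simp: S_def\<close>)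
  have "\<exists>v\<in>ball 0 1. R v \<noteq> 0"
  proof (rule ccontr)
    assume "\<not> ?thesis"
    then have R0: "R v = 0" if "v \<in> ball 0 1" for v using that by blast
    obtain i0 k0 where ik0: "(i0, k0) \<in> S" "x (i0, k0) \<noteq> 0" using nz by (auto simp: S_def)
    then have i0: "i0 \<in> A" by (simp add: S_def)
    define K where "K = Max {k. k < N i0 \<and> x (i0, k) \<noteq> 0}"
    have ne: "{k. k < N i0 \<and> x (i0, k) \<noteq> 0} \<noteq> {}" using ik0 by (auto simp: S_def)
    have "K \<in> {k. k < N i0 \<and> x (i0, k) \<noteq> 0}" unfolding K_def by (rule Max_in) (use ne in auto)
    then have K: "K < N i0" "x (i0, K) \<noteq> 0" by auto
    have KMax: "x (i0, k) = 0" if "k < N i0" "k > K" for k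
    proof (rule ccontr)
      assume "x (i0, k) \<noteq> 0"
      then have "k \<le> K" unfolding K_def using that by (intro Max_ge) auto
      with that show False by simp
    qed
    define v where "v = (\<lambda>\<epsilon>::real. cnj (t i0) * (1 - of_real \<epsilon>))"
    have tt: "t i0 * cnj (t i0) = 1" using t[OF i0] by (metis complex_norm_square of_real_1 one_power2)
    have tv: "t i0 * v \<epsilon> = 1 - of_real \<epsilon>" for \<epsilon> unfolding v_def using tt by (metis mult.assoc mult_1)
    have v_lim: "(v \<longlongrightarrow> cnj (t i0)) (at_right 0)"
      unfolding v_def by (auto intro!: tendsto_eq_intros)
    have ev: "eventually (\<lambda>\<epsilon>. \<epsilon> > 0 \<and> v \<epsilon> \<in> ball 0 1) (at_right 0)"
      using eventually_at_right_real[of 0 "1::real", simplified]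
    proof eventually_elim
      case (elim \<epsilon>)
      have "v \<epsilon> = cnj (t i0) * of_real (1 - \<epsilon>)" by (simp add: v_def)
      then have "norm (v \<epsilon>) = \<bar>1 - \<epsilon>\<bar>"
        using t[OF i0] by (simp only: norm_mult norm_of_real complex_mod_cnj mult_1)
      with elim show ?case by simp
    qed
    have lim: "((\<lambda>\<epsilon>. f a (v \<epsilon>) * of_real \<epsilon> ^ Suc K) \<longlongrightarrow> (if a = (i0, K) then x a * (-1) ^ K else 0)) (at_right 0)"
      if a: "a \<in> S" for a
    proof -
      obtain i k where ik: "a = (i, k)" by fastforce
      have i: "i \<in> A" and k: "k < N i" using a by (auto simp: S_def ik)
      show ?thesis
      proof (cases "i = i0")
        case False
        then have "t i \<noteq> t i0" using inj i i0 by (auto dest: inj_onD)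
        have "1 - t i * cnj (t i0) \<noteq> 0"
        proof
          assume "1 - t i * cnj (t i0) = 0"
          then have "t i * (t i0 * cnj (t i0)) = t i0" by (simp add: algebra_simps)
          with \<open>t i \<noteq> t i0\<close> show False unfolding tt by simp
        qed
        then have "((\<lambda>\<epsilon>. f a (v \<epsilon>) * of_real \<epsilon> ^ Suc K) \<longlongrightarrow>
            x (i, k) * ((- (t i * cnj (t i0))) ^ k / (1 - t i * cnj (t i0)) ^ Suc k) * of_real 0 ^ Suc K) (at_right 0)"
          unfolding f_def ik prod.case by (intro tendsto_intros v_lim) (auto intro: tendsto_ident_at)
        then show ?thesis using False by (simp add: ik)
      next
        case True
        show ?thesis
        proof (cases "k > K")
          case True
          then have "x a = 0" using KMax[of k] k \<open>i = i0\<close> by (simp add: ik)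
          then show ?thesis using True by (simp add: ik f_def)
        next
          case False
          have ev_eq: "eventually (\<lambda>\<epsilon>. x a * ((of_real \<epsilon> - 1) ^ k * of_real \<epsilon> ^ (K - k)) = f a (v \<epsilon>) * of_real \<epsilon> ^ Suc K) (at_right 0)"
            using ev
          proof eventually_elim
            case (elim \<epsilon>)
            have "complex_of_real \<epsilon> ^ Suc K = of_real \<epsilon> ^ Suc k * of_real \<epsilon> ^ (K - k)"
              using False by (simp flip: power_add)
            then show ?case using elim by (simp add: f_def ik \<open>i = i0\<close> tv del: power_Suc)
          qed
          have lim0: "((\<lambda>\<epsilon>. x a * ((of_real \<epsilon> - 1) ^ k * of_real \<epsilon> ^ (K - k))) \<longlongrightarrow> x a * ((of_real 0 - 1) ^ k * of_real 0 ^ (K - k))) (at_right 0)"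
            by (intro tendsto_intros)
          have "x a * ((of_real 0 - 1) ^ k * of_real 0 ^ (K - k)) = (if a = (i0, K) then x a * (-1) ^ K else 0)"
            using False \<open>i = i0\<close> by (auto simp: ik power_0_left)
          then show ?thesis using Lim_transform_eventually[OF lim0 ev_eq] by simp
        qed
      qed
    qed
    have "((\<lambda>\<epsilon>. R (v \<epsilon>) * of_real \<epsilon> ^ Suc K) \<longlongrightarrow> (\<Sum>a\<in>S. if a = (i0, K) then x a * (-1) ^ K else 0)) (at_right 0)"
      unfolding R_def sum_distrib_right by (intro tendsto_sum lim)
    moreover have "(\<Sum>a\<in>S. if a = (i0, K) then x a * (-1) ^ K else 0) = x (i0, K) * (-1) ^ K"
      using S K i0 by (simp add: S_def)
    moreover have "((\<lambda>\<epsilon>. R (v \<epsilon>) * of_real \<epsilon> ^ Suc K) \<longlongrightarrow> 0) (at_right 0)"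
      by (rule tendsto_eventually) (use ev R0 in \<open>auto elim: eventually_mono\<close>)
    ultimately have "x (i0, K) * (-1) ^ K = 0"
      using tendsto_unique[OF trivial_limit_at_right_real] by metis
    then show False using K by simp
  qed
  then obtain v0 where v0: "v0 \<in> ball 0 1" "R v0 \<noteq> 0" by blast
  have "eventually (\<lambda>v. R v \<noteq> 0 \<and> v \<in> ball 0 1) (at w)"
    by (rule non_zero_neighbour_alt[OF hol open_ball connected_ball w v0])
  then show ?thesis
    by (rule eventually_mono) (auto simp: R_def f_def S_def case_prod_unfold)
qed

section \<open>Boundary rigidity\<close>

lemma null_sequence_avoiding_countable:
  fixes S :: "real set"
  assumes "countable S"
  shows "\<exists>\<eta>. (\<forall>s::nat. 0 < \<eta> s \<and> \<eta> s \<le> 1 \<and> \<eta> s \<notin> S) \<and> \<eta> \<longlonglongrightarrow> 0"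
proof -
  have "\<exists>y. y \<in> {0<..<1 / real (Suc s)} - S" for s
  proof -
    have "uncountable ({0<..<1 / real (Suc s)} - S)"
      by (intro uncountable_minus_countable assms) (simp add: uncountable_open_interval)
    then show ?thesis by (metis countable_empty ex_in_conv)
  qed
  then obtain \<eta> where \<eta>: "\<And>s. \<eta> s \<in> {0<..<1 / real (Suc s)} - S" by metis
  have "\<eta> \<longlonglongrightarrow> 0"
  proof (rule tendsto_sandwich[OF _ _ tendsto_const LIMSEQ_inverse_real_of_nat])
    show "eventually (\<lambda>s. 0 \<le> \<eta> s) sequentially" using \<eta> by (auto intro!: always_eventually less_imp_le)
    show "eventually (\<lambda>s. \<eta> s \<le> inverse (real (Suc s))) sequentially"
      using \<eta> by (auto intro!: always_eventually less_imp_le simp: inverse_eq_divide)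
  qed
  moreover have "0 < \<eta> s \<and> \<eta> s \<le> 1 \<and> \<eta> s \<notin> S" for s
  proof -
    have "1 / real (Suc s) \<le> 1" by simp
    moreover have "\<eta> s < 1 / real (Suc s)" "0 < \<eta> s" "\<eta> s \<notin> S" using \<eta>[of s] by auto
    ultimately show ?thesis by linarith
  qed
  ultimately show ?thesis by blast
qed

text \<open>
  The point \<open>t\<close> may lie on the circle: if the zeros accumulated there, then \<open>F\<close> would vanish on a neighbourhood
  of \<open>t\<close>, which meets the connected open disk.
\<close>

lemma analytic_nonzero_eventually:
  assumes F: "F analytic_on cball 0 1" and nz: "z0 \<in> ball 0 1" "F z0 \<noteq> 0" and t: "t \<in> cball (0::complex) 1"
  shows "eventually (\<lambda>z. F z \<noteq> 0) (at t)"
proof -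
  obtain r where r: "r > 0" "F holomorphic_on ball t r"
    using F t by (meson analytic_on_def)
  have "\<exists>z\<in>ball t r. F z \<noteq> 0"
  proof (rule ccontr)
    assume "\<not> ?thesis"
    then have 0: "\<And>z. z \<in> ball t r \<Longrightarrow> F z = 0" by blast
    have "t \<in> closure (ball 0 1)" using t by simp
    then obtain y where "y \<in> ball 0 1" "dist y t < r" using r(1) unfolding closure_approachable by blast
    then have "y \<in> ball t r \<inter> ball 0 1" by (simp add: dist_commute)
    then have ne: "ball t r \<inter> ball 0 1 \<noteq> {}" by blast
    have hol: "F holomorphic_on ball 0 1"
      using F analytic_imp_holomorphic analytic_on_subset ball_subset_cball by blast
    have "F z0 = 0"
    proof (rule analytic_continuation_open[OF _ open_ball ne connected_ball inf_le2 hol, of "\<lambda>_. 0"])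
      show "F z = 0" if "z \<in> ball t r \<inter> ball 0 1" for z using 0 that by blast
    qed (use nz in \<open>auto intro: open_Int\<close>)
    then show False using nz by simp
  qed
  then obtain z1 where z1: "z1 \<in> ball t r" "F z1 \<noteq> 0" by blast
  show ?thesis
    using non_zero_neighbour_alt[OF r(2) open_ball connected_ball _ z1, of t] r(1)
    by (simp add: eventually_conj_iff)
qed

text \<open>
  Equality near \<open>w\<close> extends to \<open>w\<close> itself.  Where \<open>b\<^sub>1 = b\<^sub>2\<close> the numerator does not vanish, since \<open>b\<^sub>1\<close> and
  \<open>b\<^sub>2\<close> have no common zero; so the quotient has a pole and both sides take the value \<open>0\<close>, the left one by
  the convention on poles, the right one because it is a division by \<open>0\<close>.
\<close>

lemma blaschke_quotient_value_eq:
  assumes h: "h nicely_meromorphic_on ball 0 1" and w: "w \<in> ball 0 1"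
    and b: "b\<^sub>1 analytic_on {w}" "b\<^sub>2 analytic_on {w}" and disj: "b\<^sub>1 w \<noteq> 0 \<or> b\<^sub>2 w \<noteq> 0"
    and ne: "eventually (\<lambda>z. b\<^sub>1 z \<noteq> b\<^sub>2 z) (at w)"
    and eq: "eventually (\<lambda>z. h z = (b\<^sub>2 z + b\<^sub>1 z) / (b\<^sub>2 z - b\<^sub>1 z)) (at w)"
  shows "h w = (b\<^sub>2 w + b\<^sub>1 w) / (b\<^sub>2 w - b\<^sub>1 w)"
proof -
  have lim: "b\<^sub>1 \<midarrow>w\<rightarrow> b\<^sub>1 w" "b\<^sub>2 \<midarrow>w\<rightarrow> b\<^sub>2 w"
    using b by (auto intro!: isContD analytic_at_imp_isCont)
  show ?thesis
  proof (cases "b\<^sub>1 w = b\<^sub>2 w")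
    case True
    have "filterlim (\<lambda>z. (b\<^sub>2 z + b\<^sub>1 z) / (b\<^sub>2 z - b\<^sub>1 z)) at_infinity (at w)"
    proof (rule filterlim_divide_at_infinity)
      show "((\<lambda>z. b\<^sub>2 z + b\<^sub>1 z) \<longlongrightarrow> b\<^sub>2 w + b\<^sub>1 w) (at w)" by (intro tendsto_intros lim)
      have "((\<lambda>z. b\<^sub>2 z - b\<^sub>1 z) \<longlongrightarrow> b\<^sub>2 w - b\<^sub>1 w) (at w)" by (intro tendsto_intros lim)
      then show "filterlim (\<lambda>z. b\<^sub>2 z - b\<^sub>1 z) (at 0) (at w)"
        using ne True by (auto simp: filterlim_at elim: eventually_mono)
      show "b\<^sub>2 w + b\<^sub>1 w \<noteq> 0" using disj True by auto
    qed
    then have "filterlim h at_infinity (at w)"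
      using filterlim_cong[OF refl refl eq] by simp
    then have "\<not> (h \<midarrow>w\<rightarrow> h w)" using not_tendsto_and_filterlim_at_infinity[of "at w" h] by auto
    then have "h w = 0" using h w unfolding nicely_meromorphic_on_def by blast
    then show ?thesis using True by simp
  next
    case False
    then have "(\<lambda>z. (b\<^sub>2 z + b\<^sub>1 z) / (b\<^sub>2 z - b\<^sub>1 z)) \<midarrow>w\<rightarrow> (b\<^sub>2 w + b\<^sub>1 w) / (b\<^sub>2 w - b\<^sub>1 w)"
      by (intro tendsto_intros lim) auto
    then have l: "h \<midarrow>w\<rightarrow> (b\<^sub>2 w + b\<^sub>1 w) / (b\<^sub>2 w - b\<^sub>1 w)"
      using filterlim_cong[OF refl refl eq] by simp
    then have "\<not> is_pole h w"
      unfolding is_pole_def using not_tendsto_and_filterlim_at_infinity[of "at w" h] by auto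
    then have "h \<midarrow>w\<rightarrow> h w" using h w unfolding nicely_meromorphic_on_def by blast
    then show ?thesis using l LIM_unique by blast
  qed
qed

theorem theorem3p1:
  fixes \<kappa> r l n :: nat
    and b\<^sub>1 b\<^sub>2 g h :: "complex \<Rightarrow> complex"
    and t :: "nat \<Rightarrow> complex"
    and m :: "nat \<Rightarrow> nat"
  assumes "b\<^sub>1 \<in> blaschke_products l"
    and "b\<^sub>2 \<in> blaschke_products r"
    and "disk_zeros b\<^sub>1 \<inter> disk_zeros b\<^sub>2 = {}"
    and g_not_identically_infinite: "\<exists>z\<in>ball 0 1. b\<^sub>1 z \<noteq> b\<^sub>2 z"
    and "\<And>z. z \<in> ball 0 1 \<Longrightarrow> g z = (b\<^sub>2 z + b\<^sub>1 z) / (b\<^sub>2 z - b\<^sub>1 z)"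
    and "h \<in> caratheodory_class_le \<kappa>"
    and "inj_on t {1..n}"
    and "\<And>i. i \<in> {1..n} \<Longrightarrow> t i \<in> sphere 0 1"
    and "\<And>i M. i \<in> {1..n} \<Longrightarrow> M > 1 \<Longrightarrow>
           (\<lambda>z. h z - g z) \<in> o[at (t i) within stolz_region (t i) M](\<lambda>z. (z - t i) ^ m i)"
    and "(\<Sum>i=1..n. (m i + 1) div 2) > \<kappa> + l"
  shows "\<forall>z\<in>ball 0 1. h z = g z"
proof -
  note disj = assms(3) and g = assms(5) and asym = assms(9)
  obtain B1 e1 where B1: "B1 analytic_on cball 0 1" "\<And>p. e1 p analytic_on cball 0 1"
    "\<And>z. z \<in> ball 0 1 \<Longrightarrow> b\<^sub>1 z = B1 z"
    and dec1: "\<And>z w. z \<in> cball 0 1 \<Longrightarrow> w \<in> cball 0 1 \<Longrightarrow>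
        1 - B1 z * cnj (B1 w) = (1 - z * cnj w) * (\<Sum>p<l. e1 p z * cnj (e1 p w))"
    by (rule blaschke_kernel_decomposition[OF assms(1)]) (rule that, assumption+)
  obtain B2 e2 where B2: "B2 analytic_on cball 0 1" "\<And>p. e2 p analytic_on cball 0 1"
    "\<And>z. z \<in> ball 0 1 \<Longrightarrow> b\<^sub>2 z = B2 z"
    and dec2: "\<And>z w. z \<in> cball 0 1 \<Longrightarrow> w \<in> cball 0 1 \<Longrightarrow>
        1 - B2 z * cnj (B2 w) = (1 - z * cnj w) * (\<Sum>p<r. e2 p z * cnj (e2 p w))"
    by (rule blaschke_kernel_decomposition[OF assms(2)]) (rule that, assumption+)
  have dec1': "1 - B1 z * cnj (B1 w) = (1 - z * cnj w) * (\<Sum>p<l. e1 p z * cnj (e1 p w))"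
    and dec2': "1 - B2 z * cnj (B2 w) = (1 - z * cnj w) * (\<Sum>p<r. e2 p z * cnj (e2 p w))"
    if "z \<in> ball 0 1" "w \<in> ball 0 1" for z w
    using that by (auto intro!: dec1 dec2)
  define \<Omega> where "\<Omega> = {z \<in> ball 0 1. h analytic_on {z}}"
  define Bad where "Bad = {z \<in> ball 0 1. \<not> h analytic_on {z}}"
  obtain q where q: "q \<le> \<kappa>" and hm: "h nicely_meromorphic_on ball 0 1"
    and hneg: "has_negative_squares (caratheodory_kernel h) \<Omega> q"
    using assms(6) unfolding caratheodory_class_le_def caratheodory_class_def \<Omega>_def by auto
  have Bad: "Bad sparse_in ball 0 1"
    using hm unfolding Bad_def nicely_meromorphic_on_def
    by (intro meromorphic_on_imp_sparse_singularities') blast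
  have "countable (ball 0 1 \<inter> Bad)" by (rule sparse_imp_countable[OF open_ball Bad])
  moreover have "ball 0 1 \<inter> Bad = Bad" by (auto simp: Bad_def)
  ultimately have cBad: "countable Bad" by simp
  define A where "A = {1..n}"
  define N where "N = (\<lambda>i. (m i + 1) div 2)"
  \<comment> \<open>The nodes as functions of \<open>\<eta>\<close>, to be kept away from the countably many singularities of \<open>h\<close>.\<close>
  define pt where "pt = (\<lambda>a \<eta>. t (fst a) * (1 - complex_of_real (root (N (fst a)) \<eta>) * of_nat (Suc (snd a))))"
  define J where "J = Sigma A (\<lambda>i. {..<N i})"
  have t1: "norm (t i) = 1" if "i \<in> A" for i using assms(8) that by (auto simp: A_def)
  have J: "finite J" by (simp add: J_def A_def)
  have "countable ({0<..} \<inter> pt a -` Bad)" if "a \<in> J" for a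
  proof (rule countable_image_inj_Int_vimage[OF _ cBad])
    have a: "fst a \<in> A" "N (fst a) > 0" using that by (auto simp: J_def)
    have "t (fst a) \<noteq> 0" using t1[OF a(1)] by auto
    then show "inj_on (pt a) {0<..}"
      using a(2) by (auto intro!: inj_onI simp: pt_def simp del: of_nat_Suc)
  qed
  then have "countable (\<Union>a\<in>J. {0<..} \<inter> pt a -` Bad)" using J by (intro countable_UN) (auto intro: countable_finite)
  then obtain \<eta> :: "nat \<Rightarrow> real" where \<eta>: "\<And>s. 0 < \<eta> s" "\<And>s. \<eta> s \<le> 1" "\<eta> \<longlonglongrightarrow> 0"
    and avoid: "\<And>s. \<eta> s \<notin> (\<Union>a\<in>J. {0<..} \<inter> pt a -` Bad)"
    using null_sequence_avoiding_countable by metis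
  obtain \<alpha> :: "nat \<Rightarrow> nat \<Rightarrow> complex" where
    \<alpha>: "\<And>k q. q \<le> k \<Longrightarrow> (\<Sum>j\<le>k. \<alpha> k j * of_nat (Suc j) ^ q) = (if q = k then 1 else 0)"
    using divided_difference_weights by metis
  interpret boundary_nodes A t N \<eta> \<alpha>
    by unfold_locales (use \<eta> \<alpha> t1 in \<open>auto simp: A_def\<close>)
  have jets_J: "jets = J" by (simp add: jets_def J_def)
  have node_pt: "node s a = pt a (\<eta> s)" for s a by (simp add: node_def pt_def step_def)
  have node_\<Omega>: "eventually (\<lambda>s. node s a \<in> \<Omega>) sequentially" if "a \<in> jets" for a
    using eventually_node_in_ball[OF that]
  proof eventually_elim
    case (elim s)
    have "pt a (\<eta> s) \<notin> Bad" using avoid[of s] \<eta>(1)[of s] that by (auto simp: jets_J)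
    with elim show ?case by (auto simp: \<Omega>_def Bad_def node_pt)
  qed
  have ne: "eventually (\<lambda>z. B2 z - B1 z \<noteq> 0) (at w)" if "w \<in> cball 0 1" for w
  proof -
    obtain z0 where "z0 \<in> ball 0 1" "B2 z0 - B1 z0 \<noteq> 0" using assms(4) B1(3) B2(3) by auto
    then show ?thesis using B1(1) B2(1) that by (intro analytic_nonzero_eventually) (auto intro!: analytic_intros)
  qed
  have B_le: "norm (B1 z) \<le> 1" "norm (B2 z) \<le> 1" if "z \<in> ball 0 1" for z
    using contractive_from_kernel[of B1 z e1 l, OF dec1'[OF that that] that]
      contractive_from_kernel[of B2 z e2 r, OF dec2'[OF that that] that] .
  have tcb: "t i \<in> cball 0 1" if "i \<in> A" for i using t1[OF that] by simp
  have an1: "B1 analytic_on {t i}" "e1 p analytic_on {t i}" "B2 analytic_on {t i}" if "i \<in> A" for i p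
    using B1(1,2) B2(1) tcb[OF that] by (meson analytic_on_analytic_at)+
  have diff: "(\<lambda>s. norm (h (node s a) - g (node s a)) * step (fst a) s / (\<eta> s)\<^sup>2) \<longlonglongrightarrow> 0"
    if a: "a \<in> jets" for a
    by (rule asymptotics_at_nodes[OF a, of "m (fst a)"])
       (use asym[of "fst a" 2] jetsD(1)[OF a] in \<open>auto simp: A_def N_def\<close>)
  \<comment> \<open>\<open>g + 1 = 2 b\<^sub>2 / (b\<^sub>2 - b\<^sub>1)\<close> has modulus at least that of \<open>b\<^sub>2\<close>, which tends to \<open>1\<close>, while \<open>h - g\<close> tends to \<open>0\<close>.\<close>
  have near: "eventually (\<lambda>s. 1/2 \<le> norm (h (node s a) + 1) \<and> B2 (node s a) \<noteq> B1 (node s a) \<and> node s a \<in> ball 0 1) sequentially"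
    if a: "a \<in> jets" for a
  proof -
    have i: "fst a \<in> A" by (rule jetsD[OF a])
    have "B2 (t (fst a)) * cnj (B2 (t (fst a))) = 1"
    proof -
      have "t (fst a) * cnj (t (fst a)) = 1" using t1[OF i] by (metis complex_norm_square of_real_1 one_power2)
      then show ?thesis using dec2[OF tcb[OF i] tcb[OF i]] by simp
    qed
    then have "complex_of_real ((norm (B2 (t (fst a))))\<^sup>2) = of_real 1" by (simp only: complex_norm_square of_real_1)
    then have "(norm (B2 (t (fst a))))\<^sup>2 = 1" by (simp only: of_real_eq_iff)
    then have "norm (B2 (t (fst a))) = 1" by (simp add: power2_eq_1_iff) (smt (verit) norm_ge_zero)
    moreover have "(\<lambda>s. norm (B2 (node s a))) \<longlonglongrightarrow> norm (B2 (t (fst a)))"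
      using isCont_tendsto_compose[OF analytic_at_imp_isCont[OF an1(3)[OF i]] node_lim[OF a]] by (rule tendsto_norm)
    ultimately have "eventually (\<lambda>s. norm (B2 (node s a)) > 3/4) sequentially"
      by (intro order_tendstoD(1)) auto
    moreover have "eventually (\<lambda>s. norm (h (node s a) - g (node s a)) * step (fst a) s / (\<eta> s)\<^sup>2 < 1/4) sequentially"
      by (intro order_tendstoD(2)[OF diff[OF a]]) simp
    moreover have "eventually (\<lambda>s. B2 (node s a) - B1 (node s a) \<noteq> 0) sequentially"
    proof (rule eventually_compose_filterlim[OF ne[OF tcb[OF i]]])
      show "filterlim (\<lambda>s. node s a) (at (t (fst a))) sequentially"
        unfolding filterlim_at using node_lim[OF a] eventually_node_in_ball[OF a] t1[OF i]
        by (auto elim!: eventually_mono)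
    qed
    ultimately show ?thesis using eventually_node_in_ball[OF a]
    proof eventually_elim
      case (elim s)
      define z where "z = node s a"
      have z: "z \<in> ball 0 1" using elim by (simp add: z_def)
      have zne: "B2 z - B1 z \<noteq> 0" using elim by (simp add: z_def)
      have "norm (h z - g z) * 1 \<le> norm (h z - g z) * (step (fst a) s / (\<eta> s)\<^sup>2)"
        by (intro mult_left_mono step_ratio_ge_1[OF a]) auto
      then have hg: "norm (h z - g z) < 1/4" using elim(2) unfolding z_def[symmetric] mult_1_right times_divide_eq_right by (rule le_less_trans)
      have "norm (B2 z - B1 z) \<le> 2"
        using norm_triangle_ineq4[of "B2 z" "B1 z"] B_le[OF z] by linarith
      moreover have "(g z + 1) * (B2 z - B1 z) = 2 * B2 z"
        using zne z by (simp add: g B1(3) B2(3) field_simps)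
      then have "norm (g z + 1) * norm (B2 z - B1 z) = 2 * norm (B2 z)"
        by (metis norm_mult norm_numeral)
      ultimately have "2 * norm (B2 z) \<le> norm (g z + 1) * 2"
        by (metis mult_left_mono norm_ge_zero)
      then have "norm (g z + 1) \<ge> 3/4" using elim by (simp add: z_def)
      moreover have "norm (g z + 1) \<le> norm (h z + 1) + norm (h z - g z)"
        using norm_triangle_ineq4[of "h z + 1" "h z - g z"] by (simp add: add.commute)
      ultimately show ?case using hg zne z by (auto simp: z_def)
    qed
  qed
  have \<phi>: "(\<lambda>s. norm (B2 (node s a) * (h (node s a) - 1) / (h (node s a) + 1) - B1 (node s a)) * step (fst a) s / (\<eta> s)\<^sup>2) \<longlonglongrightarrow> 0"
    if a: "a \<in> jets" for a
  proof (rule Lim_null_comparison)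
    show "(\<lambda>s. 4 * (norm (h (node s a) - g (node s a)) * step (fst a) s / (\<eta> s)\<^sup>2)) \<longlonglongrightarrow> 0"
      by (rule tendsto_mult_right_zero[OF diff[OF a]])
    show "eventually (\<lambda>s. norm (norm (B2 (node s a) * (h (node s a) - 1) / (h (node s a) + 1) - B1 (node s a)) * step (fst a) s / (\<eta> s)\<^sup>2)
        \<le> 4 * (norm (h (node s a) - g (node s a)) * step (fst a) s / (\<eta> s)\<^sup>2)) sequentially"
      using near[OF a]
    proof eventually_elim
      case (elim s)
      define z where "z = node s a"
      have z: "z \<in> ball 0 1" "B2 z - B1 z \<noteq> 0" "1/2 \<le> norm (h z + 1)" using elim by (auto simp: z_def)
      then have nz: "h z + 1 \<noteq> 0" by auto
      have "g z * (B2 z - B1 z) = B2 z + B1 z"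
        using z by (simp add: g B1(3) B2(3))
      then have "B2 z * (h z - 1) / (h z + 1) - B1 z = (B2 z - B1 z) * (h z - g z) / (h z + 1)"
        using nz by (simp add: field_simps)
      then have "norm (B2 z * (h z - 1) / (h z + 1) - B1 z) = norm (B2 z - B1 z) * norm (h z - g z) / norm (h z + 1)"
        by (simp add: norm_mult norm_divide)
      also have "\<dots> \<le> 2 * norm (h z - g z) / (1/2)"
        using norm_triangle_ineq4[of "B2 z" "B1 z"] B_le[OF z(1)] z(3)
        by (intro frac_le mult_right_mono mult_nonneg_nonneg) auto
      finally have le: "norm (B2 z * (h z - 1) / (h z + 1) - B1 z) \<le> 4 * norm (h z - g z)" by simp
      have "step (fst a) s / (\<eta> s)\<^sup>2 \<ge> 0" using step_ratio_ge_1[OF a, of s] by linarith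
      from mult_right_mono[OF le this] show ?case
        using step_pos[OF a, of s] by (simp add: z_def abs_mult)
    qed
  qed
  have "card jets = (\<Sum>i\<in>A. N i)" unfolding jets_def using finite_A by (simp add: card_SigmaI)
  then have card: "\<kappa> + l < card jets" using assms(10) by (simp add: A_def N_def)
  have "\<exists>x. (\<exists>a\<in>jets. x a \<noteq> 0) \<and> (\<forall>p<l. jet_functional x (e1 p) = 0) \<and>
     (\<forall>w\<in>\<Omega>. cnj (h w + 1) * jet_functional x (\<lambda>z. 1 / (1 - z * cnj w))
        = cnj (B2 w * (h w - 1)) * jet_functional x (\<lambda>z. B1 z / (1 - z * cnj w)))"
  proof (rule exists_annihilating_jet[OF hneg q])
    show "\<Omega> \<subseteq> ball 0 1" by (auto simp: \<Omega>_def)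
    show "eventually (\<lambda>s. h (node s a) + 1 \<noteq> 0) sequentially" if "a \<in> jets" for a
      using near[OF that] by (auto elim: eventually_mono)
  qed (fact dec2' dec1' an1 node_\<Omega> \<phi> card)+
  then obtain x where x: "\<exists>a\<in>jets. x a \<noteq> 0" "\<forall>p<l. jet_functional x (e1 p) = 0"
    and ann: "\<And>w. w \<in> \<Omega> \<Longrightarrow> cnj (h w + 1) * jet_functional x (\<lambda>z. 1 / (1 - z * cnj w))
        = cnj (B2 w * (h w - 1)) * jet_functional x (\<lambda>z. B1 z / (1 - z * cnj w))" by blast
  define R where "R = (\<lambda>v. \<Sum>(i, k)\<in>jets. x (i, k) * ((- (t i * v)) ^ k / (1 - t i * v) ^ Suc k))"
  have R: "jet_functional x (\<lambda>z. 1 / (1 - z * cnj w)) = R (cnj w)" if "w \<in> ball 0 1" for w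
    unfolding jet_functional_def R_def using that
    by (intro sum.cong refl) (auto simp: jet_resolvent case_prod_unfold simp del: power_Suc)
  have pointwise: "h w = g w" if w: "w \<in> \<Omega>" "R (cnj w) \<noteq> 0" "B2 w - B1 w \<noteq> 0" for w
  proof -
    have wb: "w \<in> ball 0 1" using w(1) by (simp add: \<Omega>_def)
    define Q where "Q = jet_functional x (\<lambda>z. B1 z / (1 - z * cnj w))"
    have 1: "R (cnj w) = cnj (B1 w) * Q"
      unfolding R[OF wb, symmetric] Q_def
      by (rule jet_resolvent_identity[where e = e1 and l = l]) (use dec1' an1 x(2) wb in auto)
    then have "Q \<noteq> 0" using w(2) by auto
    have "cnj ((h w + 1) * B1 w) * Q = cnj (B2 w * (h w - 1)) * Q"
      using ann[OF w(1)] unfolding R[OF wb] 1 Q_def[symmetric] by (simp add: mult_ac)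
    then have "(h w + 1) * B1 w = B2 w * (h w - 1)"
      using \<open>Q \<noteq> 0\<close> by (metis complex_cnj_cancel_iff mult_right_cancel)
    then have "h w * (B2 w - B1 w) = B2 w + B1 w" by (simp add: algebra_simps)
    then show ?thesis using w(3) wb by (simp add: g B1(3) B2(3) field_simps)
  qed
  show ?thesis
  proof
    fix w :: complex assume w: "w \<in> ball 0 1"
    have "eventually (\<lambda>v. R v \<noteq> 0) (at (cnj w))"
      unfolding R_def jets_def
    proof (rule jet_functional_of_resolvent_nonzero[OF finite_A t1])
      show "inj_on t A" using assms(7) by (simp add: A_def)
      show "\<exists>a\<in>Sigma A (\<lambda>i. {..<N i}). x a \<noteq> 0" using x(1) unfolding jets_def .
    qed (use w in auto)
    moreover have "filterlim cnj (at (cnj w)) (at w)"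
      by (auto simp: filterlim_at eventually_at_filter intro!: tendsto_intros)
    ultimately have ev1: "eventually (\<lambda>v. R (cnj v) \<noteq> 0) (at w)"
      by (rule eventually_compose_filterlim)
    have "\<not> w islimpt Bad" using Bad w unfolding sparse_in_def by blast
    then have ev2: "eventually (\<lambda>v. v \<notin> Bad) (at w)" by (simp add: islimpt_iff_eventually)
    have ev3: "eventually (\<lambda>v. v \<in> ball 0 1) (at w)"
      using w by (intro eventually_at_in_open') auto
    have ev4: "eventually (\<lambda>v. B2 v - B1 v \<noteq> 0) (at w)" using ne w by simp
    have eq: "eventually (\<lambda>v. h v = (B2 v + B1 v) / (B2 v - B1 v)) (at w)"
      using ev1 ev2 ev3 ev4
    proof eventually_elim
      case (elim v)
      then have "v \<in> \<Omega>" by (auto simp: Bad_def \<Omega>_def)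
      then show ?case using pointwise[of v] elim by (simp add: g B1(3) B2(3))
    qed
    have "h w = (B2 w + B1 w) / (B2 w - B1 w)"
    proof (rule blaschke_quotient_value_eq[OF hm w _ _ _ _ eq])
      show "B1 analytic_on {w}" "B2 analytic_on {w}"
        using B1(1) B2(1) w by (auto intro: analytic_on_subset)
      show "B1 w \<noteq> 0 \<or> B2 w \<noteq> 0"
        using disj w B1(3)[OF w] B2(3)[OF w] unfolding disk_zeros_def by auto
      show "eventually (\<lambda>z. B1 z \<noteq> B2 z) (at w)" using ev4 by (auto elim: eventually_mono)
    qed
    then show "h w = g w" using w by (simp add: g B1(3) B2(3))
  qed
qed

end
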